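(* Let $(S,\rho)$ be a compact metric space, let $\mu$ be a probability measure on $S$, and let $0<\lambda<\infty$ and $0<v<\infty$. Let $(\mathcal X(t))_{t\ge0}$ be the growth process on $S$ with seed distribution $\mu$, seed arrival rate $\lambda$ and radius growth rate $v$. Let $C:=\min\{t:\mathcal X(t)=S\}$ be its cover time and let $c^*:=\max_{s\in S}\mathbb{E}C(s)$, where $C(s):=\min\{t:s\in\mathcal X(t)\}$ is the time at which the point $s$ is covered. Then $$\mathrm{var}\left(\frac{C}{\mathbb{E}C}\right)\le\frac{c^*}{\mathbb{E}C}.$$
   Context: Balls are closed: $\mathrm{ball}(s,r)=\{s'\in S:\rho(s,s')\le r\}$. Growth process: let $0<\tau_1<\tau_2<\cdots$ be the times of a rate-$\lambda$ Poisson process on $(0,\infty)$ and, independently, let $\sigma_1,\sigma_2,\ldots$ be i.i.d. random points of $S$ with distribution $\mu$. A seed arrives at position $\sigma_i$ at time $\tau_i$ and creates a ball whose radius then grows at rate $v$; that is, $$\mathcal X(t):=\bigcup_{i:\tau_i\le t}\mathrm{ball}(\sigma_i,v(t-\tau_i)).$$ *)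

theory Defs
  imports "HOL-Probability.Probability"
begin

text \<open>
  The numbering of seeds starts at 0. A sample space \<open>M\<close> carries the arrival times
  \<open>\<tau> i\<close> and the positions \<open>\<sigma> i\<close>; the underlying compact space is the whole type \<open>'a\<close>.
\<close>

definition gap :: "(nat \<Rightarrow> 'w \<Rightarrow> real) \<Rightarrow> nat \<Rightarrow> 'w \<Rightarrow> real" where
  "gap \<tau> i \<omega> = (case i of 0 \<Rightarrow> \<tau> 0 \<omega> | Suc j \<Rightarrow> \<tau> (Suc j) \<omega> - \<tau> j \<omega>)"

text \<open>
  A Poisson process on \<open>(0,\<infinity>)\<close> is given by its i.i.d. exponential waiting times. In particular
  \<open>0 < \<tau> 0 < \<tau> 1 < \<dots>\<close> and \<open>\<tau> i \<rightarrow> \<infinity>\<close> hold almost surely; they are not required on null sets.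
\<close>
definition poisson_times :: "'w measure \<Rightarrow> real \<Rightarrow> (nat \<Rightarrow> 'w \<Rightarrow> real) \<Rightarrow> bool" where
  "poisson_times M l \<tau> \<longleftrightarrow>
     prob_space.indep_vars M (\<lambda>_. borel) (gap \<tau>) UNIV \<and>
     (\<forall>i. distributed M lborel (gap \<tau> i) (exponential_density l))"

definition iid_points ::
    "'w measure \<Rightarrow> 'a::metric_space measure \<Rightarrow> (nat \<Rightarrow> 'w \<Rightarrow> 'a) \<Rightarrow> bool" where
  "iid_points M \<mu> \<sigma> \<longleftrightarrow>
     prob_space.indep_vars M (\<lambda>_. borel) \<sigma> UNIV \<and>
     (\<forall>i. distr M borel (\<sigma> i) = \<mu>)"

text \<open>
  \<^const>\<open>prob_space.indep_var\<close> wants both variables to have the same value type, so independence of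
  the two sequences is expressed through the sigma-algebras they generate.
\<close>
definition indep_sequences ::
    "'w measure \<Rightarrow> (nat \<Rightarrow> 'w \<Rightarrow> real) \<Rightarrow> (nat \<Rightarrow> 'w \<Rightarrow> 'a::metric_space) \<Rightarrow> bool" where
  "indep_sequences M \<tau> \<sigma> \<longleftrightarrow>
     prob_space.indep_set M
       (sets (vimage_algebra (space M) (\<lambda>\<omega> i. \<tau> i \<omega>) (Pi\<^sub>M UNIV (\<lambda>_. borel))))
       (sets (vimage_algebra (space M) (\<lambda>\<omega> i. \<sigma> i \<omega>) (Pi\<^sub>M UNIV (\<lambda>_. borel))))"

definition grown_set ::
    "real \<Rightarrow> (nat \<Rightarrow> 'w \<Rightarrow> real) \<Rightarrow> (nat \<Rightarrow> 'w \<Rightarrow> 'a::metric_space) \<Rightarrow> 'w \<Rightarrow> real \<Rightarrow> 'a set" where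
  "grown_set v \<tau> \<sigma> \<omega> t = (\<Union>i\<in>{i. \<tau> i \<omega> \<le> t}. cball (\<sigma> i \<omega>) (v * (t - \<tau> i \<omega>)))"

definition covering_times ::
    "real \<Rightarrow> (nat \<Rightarrow> 'w \<Rightarrow> real) \<Rightarrow> (nat \<Rightarrow> 'w \<Rightarrow> 'a::metric_space) \<Rightarrow> 'w \<Rightarrow> real set" where
  "covering_times v \<tau> \<sigma> \<omega> = {t. 0 \<le> t \<and> grown_set v \<tau> \<sigma> \<omega> t = UNIV}"

definition point_covering_times ::
    "real \<Rightarrow> (nat \<Rightarrow> 'w \<Rightarrow> real) \<Rightarrow> (nat \<Rightarrow> 'w \<Rightarrow> 'a::metric_space) \<Rightarrow> 'a \<Rightarrow> 'w \<Rightarrow> real set" where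
  "point_covering_times v \<tau> \<sigma> s \<omega> = {t. 0 \<le> t \<and> s \<in> grown_set v \<tau> \<sigma> \<omega> t}"

text \<open>
  The minima are almost surely attained. Using \<^const>\<open>Inf\<close> gives a definite (and measurable) value
  also on the null set of samples whose arrival times accumulate.
\<close>
definition cover_time ::
    "real \<Rightarrow> (nat \<Rightarrow> 'w \<Rightarrow> real) \<Rightarrow> (nat \<Rightarrow> 'w \<Rightarrow> 'a::metric_space) \<Rightarrow> 'w \<Rightarrow> real" where
  "cover_time v \<tau> \<sigma> \<omega> = Inf (covering_times v \<tau> \<sigma> \<omega>)"

definition point_cover_time ::
    "real \<Rightarrow> (nat \<Rightarrow> 'w \<Rightarrow> real) \<Rightarrow> (nat \<Rightarrow> 'w \<Rightarrow> 'a::metric_space) \<Rightarrow> 'a \<Rightarrow> 'w \<Rightarrow> real" where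
  "point_cover_time v \<tau> \<sigma> s \<omega> = Inf (point_covering_times v \<tau> \<sigma> s \<omega>)"

definition max_mean_point_cover_time ::
    "'w measure \<Rightarrow> real \<Rightarrow> (nat \<Rightarrow> 'w \<Rightarrow> real) \<Rightarrow> (nat \<Rightarrow> 'w \<Rightarrow> 'a::metric_space) \<Rightarrow> real" where
  "max_mean_point_cover_time M v \<tau> \<sigma> =
     (SUP s. prob_space.expectation M (point_cover_time v \<tau> \<sigma> s))"

end

theory Submission
  imports Defs
begin

text \<open>
  Let \<open>h(X)\<close> be the mean remaining cover time when the covered set is \<open>X\<close>. A new seed at \<open>x\<close> lowers
  \<open>h\<close> by at most \<open>c*\<close>, since after waiting until \<open>x\<close> is covered one is at least as far as with
  the new seed. Along the process, \<open>t + h(X(t))\<close> is a martingale, and \<open>h\<close> also decreases through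
  the growth between seeds, so its jumps decrease it at mean rate at most 1. Hence the variance, the
  mean sum of squared jumps, grows at rate at most \<open>c*\<close>, which gives \<open>var C \<le> c* E C\<close>.

  Both the jump bound and the variance bound are obtained from a one-seed renewal inequality
  \<open>e(X) \<le> E e(X')\<close>, where \<open>X'\<close> is the configuration at the first seed. If growth alone finishes
  before the first seed then \<open>e(X') = 0\<close>; for a truncated cover time this has probability bounded
  below, so the supremum of \<open>e\<close> is at most a fixed fraction \<open>< 1\<close> of itself and cannot be positive.
\<close>

section \<open>Exponential waiting times\<close>

text \<open>Going from one seed to the next leaves a single exponential clock: until it rings the
  configuration evolves deterministically, so the martingale is an explicit function
  \<open>P\<close> solving a linear ODE, and its second moment follows from the fundamental theorem
  of calculus. A jump d with 0 \<le> d \<le> c satisfies d^2 \<le> c d, so the quadratic term is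
  paid for by the mean jump, which in turn is at most the mean elapsed time. The obstacle is that
  comparing a supremum with a fraction of itself says nothing if it is infinite. Truncation at a
  level \<open>a\<close> therefore does two jobs: it bounds all moments, and it bounds the time that
  growth alone needs, so that the next seed comes too late with probability at least
  \<open>exp (- (l * a))\<close>. The constant \<open>c\<close> does not depend on the level,
  because truncation only shortens the covering of points; hence the level can be sent to infinity
  at the end.\<close>

lemma contraction_bound:
  fixes A :: "real set"
  assumes "bdd_above A" "\<theta> < 1"
    and step: "\<And>S z. 0 \<le> S \<Longrightarrow> (\<And>z. z \<in> A \<Longrightarrow> z \<le> S) \<Longrightarrow> z \<in> A \<Longrightarrow> z \<le> S * \<theta>"
    and "z \<in> A"
  shows "z \<le> 0"
proof (rule ccontr)
  assume "\<not> z \<le> 0"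
  moreover have "z \<le> Sup A"
    using assms by (intro cSup_upper)
  ultimately have pos: "0 < Sup A" by simp
  \<comment> \<open>A positive supremum is itself an admissible \<open>S\<close>. The restriction to
    \<open>S \<ge> 0\<close> in \<open>step\<close> lets a factor \<open>1 - exp (- (l * r))\<close>
    be enlarged to a uniform one.\<close>
  have "Sup A \<le> Sup A * \<theta>"
  proof (rule cSup_least)
    show "y \<le> Sup A * \<theta>" if "y \<in> A" for y
      using pos that assms(1) by (intro step) (auto intro: cSup_upper)
  qed (use assms in auto)
  with pos assms(2) show False
    by (simp add: mult_le_cancel_left1)
qed

abbreviation expo :: "real \<Rightarrow> real measure" where
  "expo l \<equiv> density lborel (exponential_density l)"

lemma AE_expo_nonneg: "AE x in expo l. 0 \<le> x"
  by (subst AE_density) (auto simp: exponential_density_def)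

lemma measure_expo_lessThan:
  assumes "0 < l" "0 \<le> r"
  shows "measure (expo l) {..<r} = 1 - exp (- (l * r))"
proof -
  have "emeasure (expo l) {..r} = erlang_CDF 0 l r"
    using assms(1) by (rule emeasure_erlang_density)
  moreover have "emeasure (expo l) {..<r} = emeasure (expo l) {..r}"
    by (rule emeasure_eq_AE) (auto simp: AE_density intro!: AE_I'[of "{r}"] split: if_splits)
  ultimately show ?thesis
    using assms by (simp add: measure_def erlang_CDF_0 algebra_simps)
qed

text \<open>Memorylessness: \<open>r\<close> is exceeded with probability
  \<open>exp (- (l * r))\<close>, and the excess then has the original law.\<close>

lemma integral_expo_split:
  fixes F :: "real \<Rightarrow> real"
  assumes l: "0 < l" and r: "0 \<le> r"
    and [measurable]: "F \<in> borel_measurable borel" and bd: "\<And>x. \<bar>F x\<bar> \<le> B"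
  shows "(\<integral>x. F x \<partial>expo l) =
    (\<integral>x. indicator {..<r} x * F x \<partial>expo l) + exp (- (l * r)) * (\<integral>x. F (r + x) \<partial>expo l)"
proof -
  interpret prob_space "expo l" by (rule prob_space_exponential_density[OF l])
  have "(\<integral>x. F x \<partial>expo l) = (\<integral>x. indicator {..<r} x * F x + indicator {r..} x * F x \<partial>expo l)"
    by (intro Bochner_Integration.integral_cong) (auto simp: indicator_def)
  also have "\<dots> = (\<integral>x. indicator {..<r} x * F x \<partial>expo l) + (\<integral>x. indicator {r..} x * F x \<partial>expo l)"
    using bd by (intro Bochner_Integration.integral_add integrable_const_bound[of _ B])
      (auto simp: indicator_def intro: order_trans[OF abs_ge_zero bd])
  also have "(\<integral>x. indicator {r..} x * F x \<partial>expo l) =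
      (\<integral>x. exponential_density l x * (indicator {r..} x * F x) \<partial>lborel)"
    by (subst integral_density) (use l in auto)
  also have "\<dots> = (\<integral>x. exponential_density l (r + x) * (indicator {r..} (r + x) * F (r + x)) \<partial>lborel)"
    by (subst lborel_integral_real_affine[where c = 1 and t = r]) auto
  also have "\<dots> = (\<integral>x. exp (- (l * r)) * (exponential_density l x * F (r + x)) \<partial>lborel)"
    using r by (intro Bochner_Integration.integral_cong)
      (auto simp: exponential_density_def indicator_def algebra_simps exp_add[symmetric])
  also have "\<dots> = exp (- (l * r)) * (\<integral>x. F (r + x) \<partial>expo l)"
    by (subst integral_density) (use l in auto)
  finally show ?thesis .
qed

text \<open>
  The second moment of a martingale with a single exponential jump: up to sign,
  \<open>exp (- l r) P(r)\<^sup>2\<close> is an antiderivative of the integrand times the density.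
\<close>

lemma integral_expo_square:
  fixes F :: "real \<Rightarrow> real"
  assumes l: "0 < l" and cont: "continuous_on UNIV F" and bd: "\<And>x. \<bar>F x\<bar> \<le> B"
  defines "P \<equiv> \<lambda>r. \<integral>x. F (r + x) \<partial>expo l"
  shows "(\<integral>x. 2 * P x * F x - (P x)\<^sup>2 \<partial>expo l) = (P 0)\<^sup>2"
proof -
  interpret prob_space "expo l" by (rule prob_space_exponential_density[OF l])
  have [measurable]: "F \<in> borel_measurable borel"
    using cont by (rule borel_measurable_continuous_onI)
  have B: "0 \<le> B" by (rule order_trans[OF abs_ge_zero bd])
  have P_bd: "\<bar>P r\<bar> \<le> B" for r
  proof -
    have "\<bar>P r\<bar> \<le> (\<integral>x. \<bar>F (r + x)\<bar> \<partial>expo l)"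
      unfolding P_def by (rule integral_abs_bound)
    also have "\<dots> \<le> (\<integral>x. B \<partial>expo l)"
      using bd B by (intro integral_mono integrable_const_bound[of _ B]) auto
    finally show ?thesis using prob_space by simp
  qed
  \<comment> \<open>\<open>k\<close> is \<open>F\<close> times the density on the half-line, so
    splitting at \<open>r\<close> reads
    \<open>P 0 = integral {0..r} k + exp (- (l * r)) * P r\<close>. Solved for \<open>P r\<close>,
    this shows that \<open>P\<close> is differentiable.\<close>
  define k where "k = (\<lambda>x. l * exp (- x * l) * F x)"
  have contk: "continuous_on A k" for A
    unfolding k_def by (intro continuous_intros continuous_on_subset[OF cont]) auto
  have Peq: "P r = exp (l * r) * (P 0 - integral {0..r} k)" if r: "0 \<le> r" for r
  proof -
    have "(\<integral>x. indicator {..<r} x * F x \<partial>expo l) = (\<integral>x. indicator {..r} x * F x \<partial>expo l)"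
      by (rule integral_cong_AE) (auto simp: AE_density indicator_def intro!: AE_I'[of "{r}"] split: if_splits)
    also have "\<dots> = (\<integral>x. exponential_density l x * (indicator {..r} x * F x) \<partial>lborel)"
      by (subst integral_density) (use l in auto)
    also have "\<dots> = (LINT x:{0..r}|lborel. k x)"
      unfolding set_lebesgue_integral_def
      by (intro Bochner_Integration.integral_cong) (auto simp: exponential_density_def indicator_def k_def)
    also have "\<dots> = integral {0..r} k"
      by (intro set_borel_integral_eq_integral borel_integrable_atLeastAtMost' contk)
    finally have "P 0 = integral {0..r} k + exp (- (l * r)) * P r"
      using integral_expo_split[OF l r \<open>F \<in> borel_measurable borel\<close> bd] unfolding P_def by simp
    then show ?thesis by (simp add: exp_minus field_simps)
  qed
  have dk: "((\<lambda>x. integral {0..x} k) has_real_derivative k t) (at t)" if "0 < t" for t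
  proof -
    have "((\<lambda>x. integral {0..x} k) has_real_derivative k t) (at t within {0..t+1})"
      using that by (intro integral_has_real_derivative contk) auto
    then show ?thesis
      using that by (simp add: at_within_Icc_at)
  qed
  \<comment> \<open>The martingale equation: the drift of \<open>P\<close> balances a jump from
    \<open>P\<close> to \<open>F\<close> at rate \<open>l\<close>.\<close>
  have dP: "(P has_real_derivative (l * (P t - F t))) (at t)" if t: "0 < t" for t
  proof -
    have "((\<lambda>r. exp (l * r) * (P 0 - integral {0..r} k)) has_real_derivative
       (exp (l * t) * l * (P 0 - integral {0..t} k) + exp (l * t) * (0 - k t))) (at t)"
      by (rule derivative_eq_intros dk[OF t] refl | simp)+
    also have "exp (l * t) * l * (P 0 - integral {0..t} k) + exp (l * t) * (0 - k t) = l * (P t - F t)"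
    proof -
      have "exp (l * t) * k t = l * F t"
        by (simp add: k_def exp_minus mult.commute[of t l])
      moreover have "exp (l * t) * l * (P 0 - integral {0..t} k) = l * P t"
        using t Peq[of t] by simp
      ultimately show ?thesis
        by (simp add: right_diff_distrib)
    qed
    finally show ?thesis
    proof (rule has_field_derivative_transform_within_open[of _ _ _ "{0<..}"])
    qed (use t in \<open>auto simp: Peq[symmetric]\<close>)
  qed
  have contP': "isCont P t" if "0 < t" for t
    using dP[OF that] by (rule DERIV_isCont)
  have contF: "isCont F t" for t
    using cont by (simp add: continuous_on_eq_continuous_at)
  \<comment> \<open>The explicit form holds only for \<open>r \<ge> 0\<close>, so the derivative is
    available on the open half-line and the boundary value needs a one-sided limit.\<close>
  have "(P \<longlongrightarrow> P 0) (at_right 0)"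
  proof -
    have "continuous_on {0..1} (\<lambda>r. exp (l * r) * (P 0 - integral {0..r} k))"
      by (intro continuous_intros indefinite_integral_continuous_1 integrable_continuous_real contk)
    then have "((\<lambda>r. exp (l * r) * (P 0 - integral {0..r} k)) \<longlongrightarrow> exp (l * 0) * (P 0 - integral {0..0} k))
        (at 0 within {0..1})"
      unfolding continuous_on_def by (rule bspec) simp
    then have "((\<lambda>r. exp (l * r) * (P 0 - integral {0..r} k)) \<longlongrightarrow> P 0) (at_right 0)"
      by (simp add: at_within_Icc_at_right)
    then show ?thesis
      by (rule tendsto_cong[THEN iffD1, rotated])
        (auto simp: eventually_at_filter Peq[symmetric])
  qed
  \<comment> \<open>By the equation for \<open>P\<close>, \<open>\<psi>\<close> is the derivative of
    \<open>\<Psi>\<close>; almost everywhere on the half-line it is minus the density times the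
    integrand. The boundary terms are \<open>(P 0)\<^sup>2\<close> at 0 and, as \<open>P\<close> is
    bounded, 0 at infinity.\<close>
  define \<Psi> where "\<Psi> = (\<lambda>x. exp (- (l * x)) * (P x)\<^sup>2)"
  define \<psi> where "\<psi> = (\<lambda>x. l * exp (- (l * x)) * ((P x)\<^sup>2 - 2 * P x * F x))"
  have [measurable]: "P \<in> borel_measurable borel"
    unfolding P_def by measurable
  define G where "G = (\<lambda>x. 2 * P x * F x - (P x)\<^sup>2)"
  have [measurable]: "G \<in> borel_measurable borel"
    unfolding G_def by measurable
  have "\<bar>G x\<bar> \<le> 2 * B * B + B\<^sup>2" for x
    unfolding G_def
    by (intro order_trans[OF abs_triangle_ineq4] add_mono)
      (auto simp: abs_mult intro!: mult_mono P_bd bd B, metis P_bd power2_abs power_mono abs_ge_zero)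
  then have "integrable (expo l) G"
    by (intro integrable_const_bound[of _ "2 * B * B + B\<^sup>2"]) auto
  then have int_G: "integrable lborel (\<lambda>x. exponential_density l x * G x)"
    using l by (subst (asm) integrable_density) auto
  have ae: "AE x in lborel. exponential_density l x * G x = - (indicator {0<..} x * \<psi> x)"
    by (auto simp: exponential_density_def indicator_def G_def \<psi>_def algebra_simps
      intro!: AE_I'[of "{0}"] split: if_splits)
  have "integrable lborel (\<lambda>x. - (indicator {0<..} x * \<psi> x))"
    by (rule integrable_cong_AE_imp[OF int_G _ ae]) (simp add: \<psi>_def)
  then have int: "integrable lborel (\<lambda>x. indicator {0<..} x * \<psi> x)"
    by simp
  have "(LBINT x=0..\<infinity>. \<psi> x) = 0 - (P 0)\<^sup>2"
  proof (rule interval_integral_FTC_integrable[where F = \<Psi>])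
    show "(\<Psi> has_vector_derivative \<psi> x) (at x)" if "0 < ereal x" for x
    proof -
      have "(\<Psi> has_real_derivative \<psi> x) (at x)"
        unfolding \<Psi>_def \<psi>_def using that
        by (auto intro!: derivative_eq_intros dP simp: field_simps power2_eq_square)
      then show ?thesis by (simp add: has_real_derivative_iff_has_vector_derivative)
    qed
    show "isCont \<psi> x" if "0 < ereal x" for x
      unfolding \<psi>_def using that contF contP' by (intro continuous_intros) auto
    show "set_integrable lborel (einterval 0 \<infinity>) \<psi>"
      using int by (simp add: set_integrable_def einterval_def greaterThan_def)
    have "((\<Psi>) \<longlongrightarrow> exp (- (l * 0)) * (P 0)\<^sup>2) (at_right 0)"
      unfolding \<Psi>_def by (intro tendsto_intros \<open>(P \<longlongrightarrow> P 0) (at_right 0)\<close>)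
    then show "((\<Psi> \<circ> real_of_ereal) \<longlongrightarrow> (P 0)\<^sup>2) (at_right 0)"
      unfolding zero_ereal_def ereal_tendsto_simps by simp
    have "(\<Psi> \<longlongrightarrow> 0) at_top"
    proof (rule Lim_null_comparison)
      have "(P x)\<^sup>2 \<le> B\<^sup>2" for x
        using P_bd[of x] by (metis abs_ge_zero power2_abs power_mono)
      then show "\<forall>\<^sub>F x in at_top. norm (\<Psi> x) \<le> exp (- (l * x)) * B\<^sup>2"
        by (intro always_eventually allI) (simp add: \<Psi>_def abs_mult)
      show "((\<lambda>x. exp (- (l * x)) * B\<^sup>2) \<longlongrightarrow> 0) at_top"
      proof (rule tendsto_mult_left_zero)
        have "filterlim (\<lambda>x. l * x) at_top at_top"
          using l by (intro filterlim_tendsto_pos_mult_at_top[OF tendsto_const]) (auto simp: filterlim_ident)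
        then show "((\<lambda>x. exp (- (l * x))) \<longlongrightarrow> 0) at_top"
          by (intro filterlim_compose[OF exp_at_bot]) (simp add: filterlim_uminus_at_top[symmetric])
      qed
    qed
    then show "((\<Psi> \<circ> real_of_ereal) \<longlongrightarrow> 0) (at_left \<infinity>)"
      unfolding ereal_tendsto_simps .
  qed auto
  moreover have "(LBINT x=0..\<infinity>. \<psi> x) = - (\<integral>x. G x \<partial>expo l)"
  proof -
    have "(\<integral>x. G x \<partial>expo l) = (\<integral>x. exponential_density l x * G x \<partial>lborel)"
      by (subst integral_density) (use l in auto)
    also have "\<dots> = (\<integral>x. - (indicator {0<..} x * \<psi> x) \<partial>lborel)"
      using ae by (intro integral_cong_AE) (auto simp: \<psi>_def)
    also have "\<dots> = - (LBINT x=0..\<infinity>. \<psi> x)"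
      by (simp add: interval_lebesgue_integral_0_infty set_lebesgue_integral_def)
    finally show ?thesis by simp
  qed
  ultimately show "(\<integral>x. 2 * P x * F x - (P x)\<^sup>2 \<partial>expo l) = (P 0)\<^sup>2"
    by (simp add: G_def)
qed

section \<open>Covering with initial balls\<close>

text \<open>
  Negative waiting times, which only occur on a null set, are cut off at 0. The balls present at
  time 0 are encoded by the profile \<open>u\<close>, where \<open>u s\<close> is the time at which they reach \<open>s\<close> by growth
  alone; a profile that is constantly \<open>N\<close> stands for the empty configuration truncated at time
  \<open>N\<close>. Only the points of \<open>D\<close> have to be covered: \<open>D\<close> is countable dense for the cover time
  and a singleton for the covering of a point.
\<close>

definition arrival :: "real stream \<Rightarrow> nat \<Rightarrow> real" where
  "arrival w i = (\<Sum>j\<le>i. max 0 (w !! j))"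

definition hit :: "real \<Rightarrow> real stream \<times> 'a::metric_space stream \<Rightarrow> 'a \<Rightarrow> real" where
  "hit v w s = (INF i. arrival (fst w) i + dist (snd w !! i) s / v)"

definition residual_time :: "real \<Rightarrow> 'a::metric_space set \<Rightarrow> ('a \<Rightarrow> real) \<Rightarrow> real stream \<times> 'a stream \<Rightarrow> real" where
  "residual_time v D u w = (SUP s\<in>D. min (u s) (hit v w s))"

definition grow :: "('a \<Rightarrow> real) \<Rightarrow> real \<Rightarrow> 'a \<Rightarrow> real" where
  "grow u t s = max 0 (u s - t)"

definition seed :: "real \<Rightarrow> ('a::metric_space \<Rightarrow> real) \<Rightarrow> 'a \<Rightarrow> 'a \<Rightarrow> real" where
  "seed v u x s = min (u s) (dist x s / v)"

text \<open>One level \<open>a\<close> serves for a whole history, since growth and new seeds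
  preserve it.\<close>

definition profile :: "real \<Rightarrow> ('a \<Rightarrow> real) \<Rightarrow> bool" where
  "profile a u \<longleftrightarrow> (\<forall>s. 0 \<le> u s \<and> u s \<le> a)"

lemma profileD: "profile a u \<Longrightarrow> 0 \<le> u s" "profile a u \<Longrightarrow> u s \<le> a" "profile a u \<Longrightarrow> 0 \<le> a"
  unfolding profile_def by (auto intro: order_trans)

lemma profile_grow: "profile a u \<Longrightarrow> 0 \<le> t \<Longrightarrow> profile a (grow u t)"
  unfolding profile_def grow_def by (auto intro: order_trans) (smt (verit))

lemma profile_seed: "profile a u \<Longrightarrow> 0 \<le> v \<Longrightarrow> profile a (seed v u x)"
  unfolding profile_def seed_def by (auto simp: min_le_iff_disj)

lemma arrival_nonneg: "0 \<le> arrival w i"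
  unfolding arrival_def by (intro sum_nonneg) auto

lemma arrival_Cons_0 [simp]: "arrival (t ## w) 0 = max 0 t"
  by (simp add: arrival_def)

lemma arrival_Cons_Suc [simp]: "arrival (t ## w) (Suc i) = max 0 t + arrival w i"
  unfolding arrival_def by (subst sum.atMost_Suc_shift) simp

lemma cINF_nat_split:
  fixes f :: "nat \<Rightarrow> real"
  assumes "\<And>i. b \<le> f i"
  shows "(INF i. f i) = min (f 0) (INF i. f (Suc i))"
proof -
  have "range f = insert (f 0) (range (\<lambda>i. f (Suc i)))"
    by (auto simp: image_iff) (metis not0_implies_Suc)
  also have "Inf \<dots> = min (f 0) (INF i. f (Suc i))"
    using assms by (subst cInf_insert) (auto simp: inf_min intro!: bdd_belowI[of _ b])
  finally show ?thesis .
qed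

lemma cINF_add_real:
  fixes f :: "'i \<Rightarrow> real"
  assumes "A \<noteq> {}" "\<And>i. i \<in> A \<Longrightarrow> b \<le> f i"
  shows "(INF i\<in>A. c + f i) = c + (INF i\<in>A. f i)"
proof (rule antisym)
  have bdd: "bdd_below (f ` A)" "bdd_below ((\<lambda>i. c + f i) ` A)"
    by (rule bdd_belowI2[of A b f], simp add: assms(2), rule bdd_belowI2[of A "c + b"], simp add: assms(2))
  have "(INF i\<in>A. c + f i) - c \<le> (INF i\<in>A. f i)"
    using assms(1) bdd(2) by (intro cINF_greatest) (auto simp: algebra_simps intro: cINF_lower)
  then show "(INF i\<in>A. c + f i) \<le> c + (INF i\<in>A. f i)" by simp
  show "c + (INF i\<in>A. f i) \<le> (INF i\<in>A. c + f i)"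
    using assms(1) bdd(1) by (intro cINF_greatest add_left_mono cINF_lower)
qed

context
  fixes v :: real
  assumes v: "0 < v"
begin

lemma hit_nonneg: "0 \<le> hit v w s"
  unfolding hit_def using v by (intro cINF_greatest) (auto intro!: add_nonneg_nonneg arrival_nonneg)

text \<open>The first waiting time delays every seed, so it comes out of the infimum. The cut-off in
  \<open>arrival\<close> makes this valid for negative \<open>t\<close> as well.\<close>

lemma hit_Stream:
  "hit v (t ## w1, x ## w2) s = max 0 t + min (dist x s / v) (hit v (w1, w2) s)"
proof -
  have nn: "0 \<le> arrival w i + dist (y i) s / v" for w i and y :: "nat \<Rightarrow> 'a"
    using v by (intro add_nonneg_nonneg arrival_nonneg) auto
  have "hit v (t ## w1, x ## w2) s =
      min (max 0 t + dist x s / v) (INF i. max 0 t + (arrival w1 i + dist (w2 !! i) s / v))"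
    unfolding hit_def by (subst cINF_nat_split[where b = 0]) (auto simp: nn add.assoc)
  also have "(INF i. max 0 t + (arrival w1 i + dist (w2 !! i) s / v)) = max 0 t + hit v (w1, w2) s"
    unfolding hit_def by (subst cINF_add_real[where b = 0]) (auto simp: nn)
  finally show ?thesis by (simp add: min_add_distrib_right)
qed

section \<open>Residual times of bounded profiles\<close>

context
  fixes D :: "'a::metric_space set" and a :: real
  assumes D: "D \<noteq> {}"
begin

lemma bdd_above_residual_time: "profile a u \<Longrightarrow> bdd_above ((\<lambda>s. min (u s) (hit v w s)) ` D)"
  by (intro bdd_aboveI[of _ a]) (auto simp: min_le_iff_disj profileD)

lemma residual_time_upper: "profile a u \<Longrightarrow> s \<in> D \<Longrightarrow> min (u s) (hit v w s) \<le> residual_time v D u w"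
  unfolding residual_time_def by (intro cSUP_upper bdd_above_residual_time)

lemma residual_time_nonneg: assumes "profile a u" shows "0 \<le> residual_time v D u w"
proof -
  obtain s where s: "s \<in> D" using D by auto
  have "0 \<le> min (u s) (hit v w s)"
    using assms by (auto simp: profileD hit_nonneg)
  also have "\<dots> \<le> residual_time v D u w" by (rule residual_time_upper[OF assms s])
  finally show ?thesis .
qed

lemma residual_time_le: "profile a u \<Longrightarrow> residual_time v D u w \<le> a"
  unfolding residual_time_def using D by (intro cSUP_least) (auto simp: min_le_iff_disj profileD)

lemma residual_time_zero: "residual_time v D (\<lambda>_. 0) w = 0"
  unfolding residual_time_def using D by (simp add: min_absorb1 hit_nonneg)

text \<open>With \<open>d = 0\<close> this compares configurations; with \<open>d > 0\<close> it
  yields continuity in the arrival time.\<close>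

lemma residual_time_le_add:
  assumes "profile a u'" "\<And>s. s \<in> D \<Longrightarrow> u s \<le> u' s + d" "0 \<le> d"
  shows "residual_time v D u w \<le> residual_time v D u' w + d"
  unfolding residual_time_def[of v D u]
proof (rule cSUP_least)
  fix s assume s: "s \<in> D"
  have "min (u s) (hit v w s) \<le> min (u' s) (hit v w s) + d"
    using assms(2)[OF s] assms(3) by linarith
  also have "\<dots> \<le> residual_time v D u' w + d"
    using residual_time_upper[OF assms(1) s] by simp
  finally show "min (u s) (hit v w s) \<le> residual_time v D u' w + d" .
qed (rule D)

text \<open>Until the first arrival the balls only grow; either they finish first, at the supremum
  of \<open>u\<close>, or the process restarts from the profile with the new seed. In the former
  case that profile vanishes on \<open>D\<close>, so one formula covers both.\<close>

lemma residual_time_Stream: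
  assumes u: "profile a u"
  shows "residual_time v D u (t ## w1, x ## w2) =
    min (max 0 t) (SUP s\<in>D. u s) + residual_time v D (seed v (grow u (max 0 t)) x) (w1, w2)"
proof -
  define t' where "t' = max 0 t"
  have t': "0 \<le> t'" by (simp add: t'_def)
  define u' where "u' = seed v (grow u t') x"
  define K where "K = (SUP s\<in>D. u s)"
  have bu: "bdd_above (u ` D)"
    using u by (intro bdd_aboveI[of _ a]) (auto simp: profileD)
  have uK: "u s \<le> K" if "s \<in> D" for s
    unfolding K_def using that bu by (rule cSUP_upper)
  have u': "profile a u'"
    unfolding u'_def using u t' v by (intro profile_seed profile_grow) auto
  have eq: "min (u s) (hit v (t ## w1, x ## w2) s) = min (u s) (t' + min (dist x s / v) (hit v (w1, w2) s))" for s
    by (simp add: hit_Stream t'_def)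
  have le: "min (u s) (t' + min (dist x s / v) (hit v (w1, w2) s)) \<le> min t' (u s) + min (u' s) (hit v (w1, w2) s)" for s
    using t' profileD(1)[OF u, of s] hit_nonneg[of "(w1,w2)" s] v
    unfolding u'_def seed_def grow_def by (auto simp: min_def max_def) 
  have le2: "t' + min (u' s) (hit v (w1, w2) s) \<le> min (u s) (t' + min (dist x s / v) (hit v (w1, w2) s))"
    if "t' < u s" for s
    using that t' unfolding u'_def seed_def grow_def by (auto simp: min_def max_def)
  have zero: "min (u' s) (hit v (w1, w2) s) = 0" if "u s \<le> t'" for s
    using that hit_nonneg[of "(w1,w2)" s] v unfolding u'_def seed_def grow_def by (auto simp: min_def max_def)
  show ?thesis
    unfolding t'_def[symmetric] u'_def[symmetric] K_def[symmetric]
  proof (rule antisym)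
    show "residual_time v D u (t ## w1, x ## w2) \<le> min t' K + residual_time v D u' (w1, w2)"
      unfolding residual_time_def[of v D u]
    proof (rule cSUP_least)
      fix s assume s: "s \<in> D"
      show "min (u s) (hit v (t ## w1, x ## w2) s) \<le> min t' K + residual_time v D u' (w1, w2)"
        using le[of s] uK[OF s] residual_time_upper[OF u' s, of "(w1, w2)"] unfolding eq by linarith
    qed (rule D)
    show "min t' K + residual_time v D u' (w1, w2) \<le> residual_time v D u (t ## w1, x ## w2)" (is "_ \<le> ?C")
    proof (cases "t' < K")
      case False
      then have "u s \<le> t'" if "s \<in> D" for s
        using uK[OF that] by simp
      then have "residual_time v D u' (w1, w2) = 0"
        using D zero by (simp add: residual_time_def cong: SUP_cong)
      moreover have "K \<le> ?C"
        unfolding K_def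
      proof (rule cSUP_least)
        fix s assume s: "s \<in> D"
        have "u s \<le> min (u s) (hit v (t ## w1, x ## w2) s)"
          unfolding eq using \<open>s \<in> D \<Longrightarrow> u s \<le> t'\<close>[OF s] v hit_nonneg[of "(w1,w2)" s]
          by (auto simp: min_def intro: add_increasing2)
        also have "\<dots> \<le> ?C" by (rule residual_time_upper[OF u s])
        finally show "u s \<le> ?C" .
      qed (rule D)
      ultimately show ?thesis using False by simp
    next
      case True
      have *: "t' + min (u' s) (hit v (w1, w2) s) \<le> ?C" if "s \<in> D" "t' < u s" for s
        using le2[OF that(2)] residual_time_upper[OF u that(1), of "(t ## w1, x ## w2)"] unfolding eq by linarith
      \<comment> \<open>Points with \<open>u s \<le> t'\<close> contribute 0 to the new residual
        time, so the comparison requires \<open>t' \<le> ?C\<close>; the point \<open>s0\<close>,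
        not yet reached by growth at time \<open>t'\<close>, supplies it.\<close>
      obtain s0 where s0: "s0 \<in> D" "t' < u s0"
        using True less_cSUP_iff[OF D bu] unfolding K_def by auto
      have "0 \<le> min (u' s0) (hit v (w1, w2) s0)"
        using u' by (auto simp: profileD hit_nonneg)
      with *[OF s0] have "t' \<le> ?C" by linarith
      have "residual_time v D u' (w1, w2) \<le> ?C - t'"
        unfolding residual_time_def[of v D u']
      proof (rule cSUP_least)
        fix s assume s: "s \<in> D"
        show "min (u' s) (hit v (w1, w2) s) \<le> ?C - t'"
          using *[OF s] zero[of s] \<open>t' \<le> ?C\<close> by (cases "t' < u s") auto
      qed (rule D)
      with True show ?thesis by simp
    qed
  qed
qed

end

end

section \<open>The canonical space of seeds and the renewal equation\<close>

locale growth =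
  fixes l v :: real and \<mu> :: "'a::metric_space measure"
  assumes l: "0 < l" and v: "0 < v"
    and prob_\<mu>: "prob_space \<mu>" and sets_\<mu>: "sets \<mu> = sets borel"
begin

abbreviation seeds :: "(real stream \<times> 'a stream) measure" where
  "seeds \<equiv> stream_space (expo l) \<Otimes>\<^sub>M stream_space \<mu>"

sublocale E: prob_space "expo l"
  by (rule prob_space_exponential_density[OF l])

sublocale \<mu>: prob_space \<mu>
  by (rule prob_\<mu>)

sublocale SE: prob_space "stream_space (expo l)"
  by (rule E.prob_space_stream_space)

sublocale S\<mu>: prob_space "stream_space \<mu>"
  by (rule \<mu>.prob_space_stream_space)

sublocale Q: pair_prob_space "stream_space (expo l)" "stream_space \<mu>" ..

sublocale EQ: pair_prob_space "expo l" "\<mu> \<Otimes>\<^sub>M seeds"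
proof -
  interpret pair_prob_space \<mu> seeds ..
  show "pair_prob_space (expo l) (\<mu> \<Otimes>\<^sub>M seeds)" ..
qed

sublocale \<mu>Q: pair_prob_space \<mu> seeds ..

lemma space_\<mu> [simp]: "space \<mu> = UNIV"
  using sets_eq_imp_space_eq[OF sets_\<mu>] by simp

lemma space_seeds [simp]: "space seeds = UNIV"
  by (simp add: space_pair_measure space_stream_space)

text \<open>Removing the heads of both streams leaves tails with the same joint law; Fubini moves
  the two heads outside.\<close>

lemma nn_integral_seeds:
  assumes [measurable]: "F \<in> borel_measurable seeds"
  shows "(\<integral>\<^sup>+w. F w \<partial>seeds) =
    (\<integral>\<^sup>+t. (\<integral>\<^sup>+x. (\<integral>\<^sup>+w. F (t ## fst w, x ## snd w) \<partial>seeds) \<partial>\<mu>) \<partial>expo l)"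
proof -
  interpret P: pair_prob_space "stream_space (expo l)" \<mu> ..
  have "(\<integral>\<^sup>+w. F w \<partial>seeds) = (\<integral>\<^sup>+w1. (\<integral>\<^sup>+w2. F (w1, w2) \<partial>stream_space \<mu>) \<partial>stream_space (expo l))"
    by (subst S\<mu>.nn_integral_fst) simp_all
  also have "\<dots> = (\<integral>\<^sup>+t. (\<integral>\<^sup>+w1. (\<integral>\<^sup>+w2. F (t ## w1, w2) \<partial>stream_space \<mu>) \<partial>stream_space (expo l)) \<partial>expo l)"
    by (rule E.nn_integral_stream_space) measurable
  also have "\<dots> = (\<integral>\<^sup>+t. (\<integral>\<^sup>+w1. (\<integral>\<^sup>+x. (\<integral>\<^sup>+w2. F (t ## w1, x ## w2) \<partial>stream_space \<mu>) \<partial>\<mu>)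
      \<partial>stream_space (expo l)) \<partial>expo l)"
    by (intro nn_integral_cong \<mu>.nn_integral_stream_space) measurable
  also have "\<dots> = (\<integral>\<^sup>+t. (\<integral>\<^sup>+x. (\<integral>\<^sup>+w1. (\<integral>\<^sup>+w2. F (t ## w1, x ## w2) \<partial>stream_space \<mu>)
      \<partial>stream_space (expo l)) \<partial>\<mu>) \<partial>expo l)"
    by (intro nn_integral_cong P.Fubini'[symmetric]) measurable
  also have "\<dots> = (\<integral>\<^sup>+t. (\<integral>\<^sup>+x. (\<integral>\<^sup>+w. F (t ## fst w, x ## snd w) \<partial>seeds) \<partial>\<mu>) \<partial>expo l)"
    by (intro nn_integral_cong) (subst S\<mu>.nn_integral_fst[symmetric], simp_all)
  finally show ?thesis .
qed

text \<open>As an equality of measures, the restart property transfers to Bochner integrals of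
  signed functions.\<close>

lemma distr_seeds:
  "distr (expo l \<Otimes>\<^sub>M (\<mu> \<Otimes>\<^sub>M seeds)) seeds (\<lambda>(t, x, w). (t ## fst w, x ## snd w)) = seeds"
proof (rule measure_eqI)
  fix A assume "A \<in> sets (distr (expo l \<Otimes>\<^sub>M (\<mu> \<Otimes>\<^sub>M seeds)) seeds (\<lambda>(t, x, w). (t ## fst w, x ## snd w)))"
  then have [measurable]: "A \<in> sets seeds" by simp
  have "emeasure (distr (expo l \<Otimes>\<^sub>M (\<mu> \<Otimes>\<^sub>M seeds)) seeds (\<lambda>(t, x, w). (t ## fst w, x ## snd w))) A =
      (\<integral>\<^sup>+p. indicator A p \<partial>distr (expo l \<Otimes>\<^sub>M (\<mu> \<Otimes>\<^sub>M seeds)) seeds (\<lambda>(t, x, w). (t ## fst w, x ## snd w)))"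
    by simp
  also have "\<dots> = (\<integral>\<^sup>+p. indicator A (case p of (t, x, w) \<Rightarrow> (t ## fst w, x ## snd w)) \<partial>(expo l \<Otimes>\<^sub>M (\<mu> \<Otimes>\<^sub>M seeds)))"
    by (rule nn_integral_distr) measurable
  also have "\<dots> = (\<integral>\<^sup>+t. (\<integral>\<^sup>+x. (\<integral>\<^sup>+w. indicator A (t ## fst w, x ## snd w) \<partial>seeds) \<partial>\<mu>) \<partial>expo l)"
  proof -
    have "(\<integral>\<^sup>+p. indicator A (case (t, p) of (t, x, w) \<Rightarrow> (t ## fst w, x ## snd w)) \<partial>(\<mu> \<Otimes>\<^sub>M seeds)) =
        (\<integral>\<^sup>+x. (\<integral>\<^sup>+w. indicator A (t ## fst w, x ## snd w) \<partial>seeds) \<partial>\<mu>)" for t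
    proof -
      have "(\<lambda>p. indicator A (case p of (x, w) \<Rightarrow> (t ## fst w, x ## snd w))) \<in> borel_measurable (\<mu> \<Otimes>\<^sub>M seeds)"
        by measurable
      from Q.P.nn_integral_fst[OF this] show ?thesis
        by (simp add: case_prod_beta)
    qed
    then show ?thesis
      by (subst EQ.M2.nn_integral_fst[symmetric]) simp_all
  qed
  also have "\<dots> = emeasure seeds A"
    by (subst nn_integral_seeds[symmetric]) auto
  finally show "emeasure (distr (expo l \<Otimes>\<^sub>M (\<mu> \<Otimes>\<^sub>M seeds)) seeds (\<lambda>(t, x, w). (t ## fst w, x ## snd w))) A =
    emeasure seeds A" .
qed simp

lemma integral_seeds:
  fixes F :: "_ \<Rightarrow> real"
  assumes [measurable]: "F \<in> borel_measurable seeds" and bd: "\<And>w. \<bar>F w\<bar> \<le> B"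
  shows "(\<integral>w. F w \<partial>seeds) =
    (\<integral>t. (\<integral>x. (\<integral>w. F (t ## fst w, x ## snd w) \<partial>seeds) \<partial>\<mu>) \<partial>expo l)"
proof -
  have "(\<integral>w. F w \<partial>seeds) = (\<integral>p. F (case p of (t, x, w) \<Rightarrow> (t ## fst w, x ## snd w)) \<partial>(expo l \<Otimes>\<^sub>M (\<mu> \<Otimes>\<^sub>M seeds)))"
    by (subst distr_seeds[symmetric], rule integral_distr) measurable
  also have "\<dots> = (\<integral>t. (\<integral>p. F (case p of (x, w) \<Rightarrow> (t ## fst w, x ## snd w)) \<partial>(\<mu> \<Otimes>\<^sub>M seeds)) \<partial>expo l)"
    by (subst EQ.integral_fst'[symmetric])
      (auto intro!: EQ.P.integrable_const_bound[of _ B] bd simp: case_prod_beta)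
  also have "\<dots> = (\<integral>t. (\<integral>x. (\<integral>w. F (t ## fst w, x ## snd w) \<partial>seeds) \<partial>\<mu>) \<partial>expo l)"
    by (intro Bochner_Integration.integral_cong refl, subst \<mu>Q.integral_fst'[symmetric])
      (auto intro!: EQ.M2.integrable_const_bound[of _ B] bd simp: case_prod_beta)
  finally show ?thesis .
qed

lemma borel_measurable_hit: "(\<lambda>w. hit v w s) \<in> borel_measurable seeds"
proof -
  have [measurable]: "(\<lambda>x. dist x s) \<in> borel_measurable \<mu>"
    using sets_\<mu> by (subst measurable_cong_sets[OF sets_\<mu> refl])
      (intro borel_measurable_continuous_onI continuous_intros)
  have [measurable]: "(\<lambda>w. fst w !! j) \<in> borel_measurable seeds" for j
  proof -
    have "(\<lambda>w. w !! j) \<in> stream_space (expo l) \<rightarrow>\<^sub>M expo l"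
      by measurable
    then have "(\<lambda>w. w !! j) \<in> borel_measurable (stream_space (expo l))"
      by (simp cong: measurable_cong_sets)
    then show ?thesis by measurable
  qed
  have [measurable]: "(\<lambda>w. dist (snd w !! j) s) \<in> borel_measurable seeds" for j
    by (rule measurable_compose[where g = "\<lambda>x. dist x s" and N = \<mu>]) measurable
  show ?thesis
    unfolding hit_def arrival_def by measurable
qed

text \<open>Profile and sample may both depend on \<open>p\<close>, so that the result applies on a
  product space before the sample is integrated out.\<close>

lemma borel_measurable_residual_time:
  assumes "countable D" "D \<noteq> {}" "\<And>s. s \<in> D \<Longrightarrow> (\<lambda>p. u p s) \<in> borel_measurable N"
    and "W \<in> N \<rightarrow>\<^sub>M seeds"
    and "\<And>p s. p \<in> space N \<Longrightarrow> u p s \<le> a"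
  shows "(\<lambda>p. residual_time v D (u p) (W p)) \<in> borel_measurable N"
  unfolding residual_time_def
proof (rule borel_measurable_cSUP)
  show "(\<lambda>p. min (u p s) (hit v (W p) s)) \<in> borel_measurable N" if "s \<in> D" for s
  proof -
    note [measurable] = assms(3)[OF that] measurable_compose[OF assms(4) borel_measurable_hit, of s]
    show ?thesis by measurable
  qed
  show "bdd_above ((\<lambda>s. min (u p s) (hit v (W p) s)) ` D)" if "p \<in> space N" for p
    using assms(5)[OF that] by (intro bdd_aboveI[of _ a]) (auto simp: min_le_iff_disj)
qed (use assms in auto)

end

text \<open>The map from \<open>x\<close> to \<open>max 0 (x - r)\<close> is monotone and
  continuous, hence commutes with suprema. For \<open>grow\<close> this tells how much time growth
  alone still needs after \<open>r\<close>.\<close>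

lemma SUP_max_diff:
  fixes u :: "'a \<Rightarrow> real"
  assumes "D \<noteq> {}" "bdd_above (u ` D)"
  shows "(SUP s\<in>D. max 0 (u s - r)) = max 0 ((SUP s\<in>D. u s) - r)"
proof -
  have "mono (\<lambda>x::real. max 0 (x - r))"
    by (auto simp: mono_def)
  moreover have "continuous (at_left (Sup (u ` D))) (\<lambda>x::real. max 0 (x - r))"
    by (intro continuous_intros)
  ultimately have "max 0 (Sup (u ` D) - r) = (SUP x\<in>u ` D. max 0 (x - r))"
    using assms by (intro continuous_at_Sup_mono) auto
  then show ?thesis by (simp add: image_comp)
qed

lemma grow_grow: "0 \<le> r \<Longrightarrow> 0 \<le> t \<Longrightarrow> grow (grow u r) t = grow u (r + t)"
  by (auto simp: grow_def fun_eq_iff)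

lemma grow_0: "profile a u \<Longrightarrow> grow u 0 = u"
  by (auto simp: grow_def fun_eq_iff profileD)

section \<open>Moments of the residual time as functions of the profile\<close>

context growth
begin

text \<open>This is \<open>h(X)\<close> for the configuration \<open>X\<close> encoded by
  \<open>u\<close>.\<close>

definition mean :: "'a set \<Rightarrow> ('a \<Rightarrow> real) \<Rightarrow> real" where
  "mean D u = (\<integral>w. residual_time v D u w \<partial>seeds)"

definition second_moment :: "'a set \<Rightarrow> ('a \<Rightarrow> real) \<Rightarrow> real" where
  "second_moment D u = (\<integral>w. (residual_time v D u w)\<^sup>2 \<partial>seeds)"

definition step :: "('a \<Rightarrow> real) \<Rightarrow> real \<Rightarrow> 'a \<Rightarrow> 'a \<Rightarrow> real" where
  "step u t x = seed v (grow u (max 0 t)) x"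

text \<open>The mean of the residual time, given that the first seed arrives at time \<open>t\<close>.\<close>

definition renewal :: "'a set \<Rightarrow> ('a \<Rightarrow> real) \<Rightarrow> real \<Rightarrow> real" where
  "renewal D u t = min (max 0 t) (SUP s\<in>D. u s) + (\<integral>x. mean D (step u t x) \<partial>\<mu>)"

lemma profile_step: "profile a u \<Longrightarrow> profile a (step u t x)"
  unfolding step_def using v by (intro profile_seed profile_grow) auto

lemma borel_measurable_dist_\<mu> [measurable]: "(\<lambda>x. dist x s) \<in> borel_measurable \<mu>"
  by (subst measurable_cong_sets[OF sets_\<mu> refl])
    (intro borel_measurable_continuous_onI continuous_intros)

context
  fixes D :: "'a set" and a :: real
  assumes countable: "countable D" and D: "D \<noteq> {}"
begin

lemma residual_time_measurable: "profile a u \<Longrightarrow> residual_time v D u \<in> borel_measurable seeds"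
  using borel_measurable_residual_time[OF countable D, of "\<lambda>_. u" seeds "\<lambda>w. w" a]
  by (auto simp: profileD)

lemma residual_time_bound: "profile a u \<Longrightarrow> \<bar>residual_time v D u w\<bar> \<le> a"
  using residual_time_nonneg[OF v D, of a u w] residual_time_le[OF v D, of a u w] by auto

lemma residual_time_sq_bound: "profile a u \<Longrightarrow> \<bar>(residual_time v D u w)\<^sup>2\<bar> \<le> a\<^sup>2"
  using residual_time_bound[of u w] power_mono[of "\<bar>residual_time v D u w\<bar>" a 2] by simp

lemma integrable_residual_time: "profile a u \<Longrightarrow> integrable seeds (residual_time v D u)"
  by (rule Q.P.integrable_const_bound[of _ a]) (auto simp: residual_time_bound residual_time_measurable)

lemma integrable_residual_time_sq: "profile a u \<Longrightarrow> integrable seeds (\<lambda>w. (residual_time v D u w)\<^sup>2)"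
  by (rule Q.P.integrable_const_bound[of _ "a\<^sup>2"])
    (use residual_time_sq_bound in \<open>auto intro!: borel_measurable_power residual_time_measurable\<close>)

lemma mean_nonneg: "profile a u \<Longrightarrow> 0 \<le> mean D u"
  unfolding mean_def by (intro integral_nonneg_AE AE_I2 residual_time_nonneg[OF v D])

lemma mean_le: assumes "profile a u" shows "mean D u \<le> a"
proof -
  have "mean D u \<le> (\<integral>w. a \<partial>seeds)"
    unfolding mean_def using assms by (intro integral_mono integrable_residual_time residual_time_le[OF v D]) auto
  then show ?thesis using Q.P.prob_space by simp
qed

lemma mean_bound: "profile a u \<Longrightarrow> \<bar>mean D u\<bar> \<le> a"
  using mean_nonneg[of u] mean_le[of u] by simp

lemma second_moment_bound: assumes "profile a u" shows "\<bar>second_moment D u\<bar> \<le> a\<^sup>2"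
proof -
  have "second_moment D u \<le> (\<integral>w. a\<^sup>2 \<partial>seeds)"
    unfolding second_moment_def using assms residual_time_sq_bound[OF assms]
    by (intro integral_mono integrable_residual_time_sq) auto
  then show ?thesis using Q.P.prob_space by (simp add: second_moment_def)
qed

lemma mean_zero: "mean D (\<lambda>_. 0) = 0" "second_moment D (\<lambda>_. 0) = 0"
  by (simp_all add: mean_def second_moment_def residual_time_zero[OF v D])

lemma mean_le_add:
  assumes "profile a u" "profile a u'" "\<And>s. s \<in> D \<Longrightarrow> u s \<le> u' s + d" "0 \<le> d"
  shows "mean D u \<le> mean D u' + d"
proof -
  have "mean D u \<le> (\<integral>w. residual_time v D u' w + d \<partial>seeds)"
    unfolding mean_def using assms
    by (intro integral_mono integrable_residual_time Bochner_Integration.integrable_add residual_time_le_add[OF v D]) auto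
  also have "\<dots> = mean D u' + d"
    unfolding mean_def using assms(2) Q.P.prob_space by (simp add: integrable_residual_time)
  finally show ?thesis .
qed

lemma mean_measurable:
  assumes "\<And>s. s \<in> D \<Longrightarrow> (\<lambda>p. u p s) \<in> borel_measurable N" "\<And>p. profile a (u p)"
  shows "(\<lambda>p. mean D (u p)) \<in> borel_measurable N"
    and "(\<lambda>p. second_moment D (u p)) \<in> borel_measurable N"
proof -
  have [measurable]: "(\<lambda>p. residual_time v D (u (fst p)) (snd p)) \<in> borel_measurable (N \<Otimes>\<^sub>M seeds)"
    using assms by (intro borel_measurable_residual_time[OF countable D, of _ _ _ a]) (auto simp: profileD)
  show "(\<lambda>p. mean D (u p)) \<in> borel_measurable N"
    unfolding mean_def by (intro Q.P.borel_measurable_lebesgue_integral) (simp add: case_prod_beta)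
  show "(\<lambda>p. second_moment D (u p)) \<in> borel_measurable N"
    unfolding second_moment_def
    by (intro Q.P.borel_measurable_lebesgue_integral) (simp add: case_prod_beta)
qed

lemma step_measurable:
  assumes [measurable]: "f \<in> borel_measurable N" "g \<in> N \<rightarrow>\<^sub>M \<mu>"
  shows "(\<lambda>p. step u (f p) (g p) s) \<in> borel_measurable N"
proof -
  have [measurable]: "(\<lambda>p. dist (g p) s) \<in> borel_measurable N"
    by (rule measurable_compose[OF assms(2) borel_measurable_dist_\<mu>])
  show ?thesis
    unfolding step_def seed_def grow_def by measurable
qed

lemma mean_step_measurable:
  assumes "f \<in> borel_measurable N" "g \<in> N \<rightarrow>\<^sub>M \<mu>" "profile a u"
  shows "(\<lambda>p. mean D (step u (f p) (g p))) \<in> borel_measurable N"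
    and "(\<lambda>p. second_moment D (step u (f p) (g p))) \<in> borel_measurable N"
  using assms by (auto intro!: mean_measurable step_measurable profile_step)

context
  fixes u :: "'a \<Rightarrow> real"
  assumes u: "profile a u"
begin

lemma bdd_above_profile: "bdd_above (u ` D)"
  using u by (intro bdd_aboveI[of _ a]) (auto simp: profileD)

lemma SUP_profile: "0 \<le> (SUP s\<in>D. u s)" "(SUP s\<in>D. u s) \<le> a"
proof -
  obtain s where "s \<in> D" using D by auto
  then have "u s \<le> (SUP s\<in>D. u s)"
    by (rule cSUP_upper[OF _ bdd_above_profile])
  then show "0 \<le> (SUP s\<in>D. u s)"
    using profileD(1)[OF u] by (rule order_trans[rotated])
  show "(SUP s\<in>D. u s) \<le> a"
    using D u by (intro cSUP_least) (auto simp: profileD)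
qed

lemma integrable_mean_step: "integrable \<mu> (\<lambda>x. mean D (step u t x))"
  by (rule \<mu>.integrable_const_bound[of _ a])
    (use u in \<open>auto intro!: mean_bound profile_step mean_step_measurable\<close>)

text \<open>One \<open>a\<close> bounds the elapsed time, the other the mean remaining time.\<close>

lemma renewal_bound: "\<bar>renewal D u t\<bar> \<le> 2 * a"
proof -
  have "0 \<le> (\<integral>x. mean D (step u t x) \<partial>\<mu>)"
    by (intro integral_nonneg_AE AE_I2 mean_nonneg profile_step u)
  moreover have "(\<integral>x. mean D (step u t x) \<partial>\<mu>) \<le> (\<integral>x. a \<partial>\<mu>)"
    by (intro integral_mono integrable_mean_step mean_le profile_step u) auto
  ultimately show ?thesis
    using SUP_profile \<mu>.prob_space by (auto simp: renewal_def)
qed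

text \<open>Elapsed time and mean remaining time are each 1-Lipschitz in the arrival time. The
  resulting continuity is the hypothesis of \<open>integral_expo_square\<close>.\<close>

lemma renewal_lipschitz: "\<bar>renewal D u t - renewal D u t'\<bar> \<le> 2 * \<bar>t - t'\<bar>"
proof -
  have le: "(\<integral>x. mean D (step u t x) \<partial>\<mu>) \<le> (\<integral>x. mean D (step u t' x) \<partial>\<mu>) + \<bar>t - t'\<bar>" for t t'
  proof -
    have "(\<integral>x. mean D (step u t x) \<partial>\<mu>) \<le> (\<integral>x. mean D (step u t' x) + \<bar>t - t'\<bar> \<partial>\<mu>)"
    proof (intro integral_mono integrable_mean_step Bochner_Integration.integrable_add \<mu>.integrable_const)
      fix x
      show "mean D (step u t x) \<le> mean D (step u t' x) + \<bar>t - t'\<bar>"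
        by (rule mean_le_add) (auto intro!: profile_step u, auto simp: step_def seed_def grow_def)
    qed
    then show ?thesis
      using \<mu>.prob_space by (simp add: integrable_mean_step)
  qed
  have "\<bar>min (max 0 t) K - min (max 0 t') K\<bar> \<le> \<bar>t - t'\<bar>" for K :: real
    by (auto simp: min_def max_def abs_if)
  from this[of "SUP s\<in>D. u s"] show ?thesis
    using le[of t t'] le[of t' t] abs_minus_commute[of t' t]
    unfolding renewal_def abs_le_iff[of "_ - _" "2 * _"] by (auto simp: abs_le_iff[of "_ - min _ _"])
qed

lemma continuous_on_renewal: "continuous_on UNIV (renewal D u)"
proof -
  have "2-lipschitz_on UNIV (renewal D u)"
    by (rule lipschitz_onI) (auto simp: dist_real_def renewal_lipschitz)
  then show ?thesis by (rule lipschitz_on_continuous_on)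
qed

lemma renewal_measurable [measurable]: "renewal D u \<in> borel_measurable borel"
  by (rule borel_measurable_continuous_onI[OF continuous_on_renewal])

lemma residual_time_Cons:
  "residual_time v D u (t ## fst w, x ## snd w) = min (max 0 t) (SUP s\<in>D. u s) + residual_time v D (step u t x) w"
  using residual_time_Stream[OF v D u, of t "fst w" x "snd w"] by (simp add: step_def)

lemma mean_eq_renewal: "mean D u = (\<integral>t. renewal D u t \<partial>expo l)"
proof -
  have "mean D u = (\<integral>t. (\<integral>x. (\<integral>w. min (max 0 t) (SUP s\<in>D. u s) + residual_time v D (step u t x) w \<partial>seeds) \<partial>\<mu>) \<partial>expo l)"
    unfolding mean_def by (subst integral_seeds[of _ a]) (auto simp: residual_time_measurable residual_time_bound u residual_time_Cons)
  also have "\<dots> = (\<integral>t. renewal D u t \<partial>expo l)"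
    using \<mu>.prob_space Q.P.prob_space
    by (simp add: renewal_def integrable_residual_time profile_step u integrable_mean_step flip: mean_def)
  finally show ?thesis .
qed

text \<open>Given the first seed, the second moment is the squared conditional mean plus the
  conditional variance. The variance is kept apart because the recursion is applied to it
  again.\<close>

lemma second_moment_eq:
  "second_moment D u = (\<integral>t. (\<integral>x. (min (max 0 t) (SUP s\<in>D. u s) + mean D (step u t x))\<^sup>2 +
      (second_moment D (step u t x) - (mean D (step u t x))\<^sup>2) \<partial>\<mu>) \<partial>expo l)"
proof -
  have eq: "(\<integral>w. (m + residual_time v D (step u t x) w)\<^sup>2 \<partial>seeds) =
      (m + mean D (step u t x))\<^sup>2 + (second_moment D (step u t x) - (mean D (step u t x))\<^sup>2)" for m t x
    using Q.P.prob_space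
    by (simp add: power2_sum integrable_residual_time integrable_residual_time_sq profile_step u flip: mean_def second_moment_def)
  have "second_moment D u = (\<integral>t. (\<integral>x. (\<integral>w. (min (max 0 t) (SUP s\<in>D. u s) + residual_time v D (step u t x) w)\<^sup>2 \<partial>seeds) \<partial>\<mu>) \<partial>expo l)"
    unfolding second_moment_def
    by (subst integral_seeds[of _ "a\<^sup>2"])
      (use residual_time_sq_bound in \<open>auto simp: residual_time_measurable u residual_time_Cons intro!: borel_measurable_power\<close>)
  then show ?thesis
    by (simp only: eq)
qed

text \<open>The first \<open>r\<close> time units are pure growth, and with \<open>K\<close> the
  supremum of \<open>u\<close> the elapsed time splits as
  \<open>min (r + t) K = min r K + min t (max 0 (K - r))\<close>.\<close>

lemma renewal_shift:
  assumes r: "0 \<le> r" and t: "0 \<le> t"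
  shows "renewal D u (r + t) = min r (SUP s\<in>D. u s) + renewal D (grow u r) t"
proof -
  have "step u (r + t) = step (grow u r) t"
    using r t by (auto simp: step_def grow_grow max_def fun_eq_iff)
  moreover have "(SUP s\<in>D. grow u r s) = max 0 ((SUP s\<in>D. u s) - r)"
    unfolding grow_def by (rule SUP_max_diff[OF D bdd_above_profile])
  ultimately show ?thesis
    using r t SUP_profile(1) by (simp add: renewal_def)
qed

end

text \<open>By memorylessness the left side is the conditional mean given no seed before
  \<open>r\<close>. The right side is the martingale \<open>t + h(X(t))\<close> at time
  \<open>r\<close>, with its clock stopped once growth has finished.\<close>

lemma integral_renewal_shift:
  assumes u: "profile a u" and r: "0 \<le> r"
  shows "(\<integral>t. renewal D u (r + t) \<partial>expo l) = min r (SUP s\<in>D. u s) + mean D (grow u r)"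
proof -
  note [measurable] = renewal_measurable[OF u] renewal_measurable[OF profile_grow[OF u r]]
  have "(\<integral>t. renewal D u (r + t) \<partial>expo l) = (\<integral>t. min r (SUP s\<in>D. u s) + renewal D (grow u r) t \<partial>expo l)"
    using AE_expo_nonneg[of l] by (intro integral_cong_AE) (auto simp: renewal_shift[OF u r])
  also have "\<dots> = min r (SUP s\<in>D. u s) + mean D (grow u r)"
    using E.prob_space
    by (subst Bochner_Integration.integral_add)
      (auto simp: mean_eq_renewal[OF profile_grow[OF u r]]
        intro!: E.integrable_const_bound[of _ "2 * a"] renewal_bound[OF profile_grow[OF u r]])
  finally show ?thesis .
qed

text \<open>\<open>P t\<close> is the martingale just before a seed at time \<open>t\<close>, and
  the seed lowers it by some \<open>d\<close> between 0 and \<open>c\<close>. Since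
  \<open>d * d \<le> c * d\<close>, the square of \<open>P t - d\<close> is bounded by terms linear
  in \<open>d\<close>, whose mean over the position is \<open>P t - F t\<close>. The part quadratic
  in \<open>P\<close> and \<open>F\<close> integrates to \<open>(mean D u)\<^sup>2\<close>.\<close>

lemma integral_square_step_le:
  assumes u: "profile a u"
    and jump: "\<And>u x. profile a u \<Longrightarrow> mean D u \<le> mean D (seed v u x) + c"
  defines "m \<equiv> \<lambda>t. min (max 0 t) (SUP s\<in>D. u s)"
  shows "(\<integral>t. (\<integral>x. (m t + mean D (step u t x))\<^sup>2 \<partial>\<mu>) \<partial>expo l) \<le> (mean D u)\<^sup>2 + c * (\<integral>t. m t \<partial>expo l)"
proof -
  define F where "F = renewal D u"
  define P where "P = (\<lambda>r. \<integral>t. F (r + t) \<partial>expo l)"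
  have a: "0 \<le> a" by (rule profileD(3)[OF u])
  have [measurable]: "F \<in> borel_measurable borel"
    unfolding F_def by (rule renewal_measurable[OF u])
  have [measurable]: "P \<in> borel_measurable borel"
    unfolding P_def by measurable
  have F_bd: "\<bar>F t\<bar> \<le> 2 * a" for t
    unfolding F_def by (rule renewal_bound[OF u])
  have m_bd: "0 \<le> m t" "m t \<le> a" for t
    using SUP_profile[OF u] by (auto simp: m_def)
  have m_meas [measurable]: "m \<in> borel_measurable borel"
    unfolding m_def by measurable
  \<comment> \<open>A seed at any point can only lower the mean, so a bound on the drop is
    nonnegative.\<close>
  have c: "0 \<le> c"
  proof -
    fix x :: 'a
    have "mean D (seed v u x) \<le> mean D u + 0"
      using u v by (intro mean_le_add profile_seed) (auto simp: seed_def)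
    then show ?thesis using jump[OF u, of x] by simp
  qed
  have P_bd: "\<bar>P r\<bar> \<le> 2 * a" for r
  proof -
    have "\<bar>P r\<bar> \<le> (\<integral>x. \<bar>F (r + x)\<bar> \<partial>expo l)"
      unfolding P_def by (rule integral_abs_bound)
    also have "\<dots> \<le> (\<integral>x. 2 * a \<partial>expo l)"
      using F_bd a by (intro integral_mono E.integrable_const_bound[of _ "2 * a"]) auto
    finally show ?thesis using E.prob_space by simp
  qed
  have P_eq: "P t = m t + mean D (grow u t)" if "0 \<le> t" for t
    using integral_renewal_shift[OF u that] that by (simp add: P_def F_def m_def)
  have P0: "P 0 = mean D u"
    using P_eq[of 0] SUP_profile[OF u] by (simp add: m_def grow_0[OF u])
  have step_bd: "\<bar>(m t + mean D (step u t x))\<^sup>2\<bar> \<le> (2 * a)\<^sup>2" for t x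
    using m_bd[of t] mean_nonneg[OF profile_step[OF u], of t x] mean_le[OF profile_step[OF u], of t x]
      power_mono[of "m t + mean D (step u t x)" "2 * a" 2] by simp
  have step_meas [measurable]: "(\<lambda>x. mean D (step u t x)) \<in> borel_measurable \<mu>" for t
    by (intro mean_step_measurable u) auto
  have pointwise: "(\<integral>x. (m t + mean D (step u t x))\<^sup>2 \<partial>\<mu>) \<le>
      (2 * P t * F t - (P t)\<^sup>2) + c * (m t + mean D u - F t)" if t: "0 \<le> t" for t
  proof -
    have le: "(m t + mean D (step u t x))\<^sup>2 \<le> (P t)\<^sup>2 + (c - 2 * P t) * (P t - m t - mean D (step u t x))" for x
    proof -
      define d where "d = P t - m t - mean D (step u t x)"
      have d: "d = mean D (grow u t) - mean D (seed v (grow u t) x)"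
        using t by (simp add: d_def P_eq step_def)
      have "0 \<le> d"
        using mean_le_add[of "seed v (grow u t) x" "grow u t" 0] u t v
        by (auto simp: d seed_def profile_grow profile_seed)
      moreover have "d \<le> c"
        using jump[OF profile_grow[OF u t], of x] by (simp add: d)
      ultimately have "d * d \<le> c * d" by (intro mult_right_mono)
      moreover have eq: "m t + mean D (step u t x) = P t - d"
        by (simp add: d_def)
      ultimately show ?thesis
        unfolding d_def[symmetric] eq by (simp add: power2_eq_square algebra_simps)
    qed
    have "(\<integral>x. (m t + mean D (step u t x))\<^sup>2 \<partial>\<mu>) \<le>
        (\<integral>x. (P t)\<^sup>2 + (c - 2 * P t) * (P t - m t - mean D (step u t x)) \<partial>\<mu>)"
    proof (rule integral_mono[OF _ _ le])
      show "integrable \<mu> (\<lambda>x. (m t + mean D (step u t x))\<^sup>2)"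
        using step_bd by (intro \<mu>.integrable_const_bound[of _ "(2 * a)\<^sup>2"]) auto
      show "integrable \<mu> (\<lambda>x. (P t)\<^sup>2 + (c - 2 * P t) * (P t - m t - mean D (step u t x)))"
        by (intro Bochner_Integration.integrable_add Bochner_Integration.integrable_diff
          integrable_mult_right integrable_mean_step u \<mu>.integrable_const)
    qed
    also have "\<dots> = (P t)\<^sup>2 + (c - 2 * P t) * (P t - F t)"
      using \<mu>.prob_space by (simp add: integrable_mean_step[OF u] F_def renewal_def m_def)
    also have "\<dots> = (2 * P t * F t - (P t)\<^sup>2) + c * (P t - F t)"
      by (simp add: power2_eq_square algebra_simps)
    \<comment> \<open>Here the decrease of the mean through growth is given away. What remains
      integrates exactly, because \<open>F\<close> has mean \<open>mean D u\<close>.\<close>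
    also have "c * (P t - F t) \<le> c * (m t + mean D u - F t)"
    proof (intro mult_left_mono c)
      have "mean D (grow u t) \<le> mean D u + 0"
        using u t by (intro mean_le_add profile_grow) (auto simp: grow_def profileD)
      then show "P t - F t \<le> m t + mean D u - F t"
        by (simp add: P_eq[OF t])
    qed
    finally show ?thesis by simp
  qed
  have int_F: "integrable (expo l) F" and int_m: "integrable (expo l) m"
    using F_bd m_bd by (auto intro!: E.integrable_const_bound[of _ "2 * a"] E.integrable_const_bound[of m a])
  have int_PF: "integrable (expo l) (\<lambda>t. 2 * P t * F t - (P t)\<^sup>2)"
  proof (rule Bochner_Integration.integrable_diff)
    show "integrable (expo l) (\<lambda>t. 2 * P t * F t)"
    proof (rule E.integrable_const_bound[of _ "2 * (2 * a) * (2 * a)"])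
      have "\<bar>F t\<bar> * \<bar>P t\<bar> \<le> (2 * a) * (2 * a)" for t
        using P_bd F_bd a by (intro mult_mono) auto
      then show "AE t in expo l. norm (2 * P t * F t) \<le> 2 * (2 * a) * (2 * a)"
        by (simp add: abs_mult mult_ac)
    qed measurable
    show "integrable (expo l) (\<lambda>t. (P t)\<^sup>2)"
      using power_mono[OF P_bd abs_ge_zero, of _ 2]
      by (intro E.integrable_const_bound[of _ "(2 * a)\<^sup>2"]) auto
  qed
  have "(\<integral>t. (\<integral>x. (m t + mean D (step u t x))\<^sup>2 \<partial>\<mu>) \<partial>expo l) \<le>
      (\<integral>t. (2 * P t * F t - (P t)\<^sup>2) + c * (m t + mean D u - F t) \<partial>expo l)"
  proof (rule integral_mono_AE)
    have [measurable]: "(\<lambda>p. mean D (step u (fst p) (snd p))) \<in> borel_measurable (expo l \<Otimes>\<^sub>M \<mu>)"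
      by (intro mean_step_measurable u) measurable
    have "(\<lambda>t. \<integral>x. (m t + mean D (step u t x))\<^sup>2 \<partial>\<mu>) \<in> borel_measurable (expo l)"
      by (intro \<mu>.borel_measurable_lebesgue_integral) (simp add: case_prod_beta)
    moreover have "\<bar>\<integral>x. (m t + mean D (step u t x))\<^sup>2 \<partial>\<mu>\<bar> \<le> (2 * a)\<^sup>2" for t
    proof -
      have "(\<integral>x. (m t + mean D (step u t x))\<^sup>2 \<partial>\<mu>) \<le> (\<integral>x. (2 * a)\<^sup>2 \<partial>\<mu>)"
        using step_bd by (intro integral_mono \<mu>.integrable_const_bound[of _ "(2 * a)\<^sup>2"]) auto
      then show ?thesis using \<mu>.prob_space by simp
    qed
    ultimately show "integrable (expo l) (\<lambda>t. \<integral>x. (m t + mean D (step u t x))\<^sup>2 \<partial>\<mu>)"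
      by (intro E.integrable_const_bound[of _ "(2 * a)\<^sup>2"]) auto
    show "integrable (expo l) (\<lambda>t. (2 * P t * F t - (P t)\<^sup>2) + c * (m t + mean D u - F t))"
      using int_F int_m int_PF by auto
    show "AE t in expo l. (\<integral>x. (m t + mean D (step u t x))\<^sup>2 \<partial>\<mu>) \<le>
        (2 * P t * F t - (P t)\<^sup>2) + c * (m t + mean D u - F t)"
      using AE_expo_nonneg[of l] pointwise by auto
  qed
  also have "\<dots> = (\<integral>t. 2 * P t * F t - (P t)\<^sup>2 \<partial>expo l) + c * (\<integral>t. m t + mean D u - F t \<partial>expo l)"
    using int_F int_m by (subst Bochner_Integration.integral_add[OF int_PF]) auto
  also have "(\<integral>t. 2 * P t * F t - (P t)\<^sup>2 \<partial>expo l) = (mean D u)\<^sup>2"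
    using integral_expo_square[OF l continuous_on_renewal[OF u] renewal_bound[OF u]] P0
    unfolding P_def F_def by simp
  also have "(\<integral>t. m t + mean D u - F t \<partial>expo l) = (\<integral>t. m t \<partial>expo l)"
    using int_F int_m E.prob_space mean_eq_renewal[OF u] by (simp add: F_def)
  finally show ?thesis .
qed

end

section \<open>Jumps and variance\<close>

lemma integral_lessThan_const:
  assumes "0 \<le> r"
  shows "(\<integral>t. indicator {..<r} t * S \<partial>expo l) = S * (1 - exp (- (l * r)))"
  using measure_expo_lessThan[OF l assms] by simp

text \<open>
  Once the point \<open>x\<close> is covered, the configuration has caught up with the original one enlarged by
  a seed at \<open>x\<close>. Instead of the strong Markov property at the time when \<open>x\<close> is covered, the proof
  follows pairs \<open>(u, r)\<close> from seed to seed, where \<open>r\<close> is the time at which the balls present would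
  cover \<open>x\<close>.
\<close>

lemma jump_bound:
  assumes D: "countable D" "D \<noteq> {}" and u0: "profile a u0"
  shows "mean D u0 \<le> mean {x} (\<lambda>_. a) + mean D (seed v u0 x)"
proof -
  define w where "w = seed v u0 x"
  have w: "profile a w"
    unfolding w_def using u0 v by (intro profile_seed) auto
  have a: "0 \<le> a" by (rule profileD(3)[OF u0])
  have X: "countable {x}" "{x} \<noteq> {}" by auto
  \<comment> \<open>The balls of \<open>u\<close> reach each point no later than those of
    \<open>u0\<close>, and no later than a ball started at \<open>x\<close> at time
    \<open>r\<close>. Hence \<open>grow u r\<close> is at most \<open>w\<close>. The pair
    \<open>(u0, a)\<close> qualifies since \<open>u0\<close> is bounded by \<open>a\<close>.\<close>
  define ok where "ok = (\<lambda>u r. 0 \<le> r \<and> r \<le> a \<and> profile a u \<and> (\<forall>s. u s \<le> u0 s \<and> u s \<le> r + dist x s / v))"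
  \<comment> \<open>On a singleton the constant profile \<open>r\<close> describes balls that would
    reach \<open>x\<close> at time \<open>r\<close>; \<open>w\<close> stays fixed
    throughout.\<close>
  define e where "e = (\<lambda>u r. mean D u - mean {x} (\<lambda>_. r) - mean D w)"
  have const: "profile a (\<lambda>_. r)" if "0 \<le> r" "r \<le> a" for r
    using that by (auto simp: profile_def)
  have "e u0 a \<le> 0"
  proof (rule contraction_bound)
    show "bdd_above {e u r | u r. ok u r}"
    proof (rule bdd_aboveI)
      fix z assume "z \<in> {e u r | u r. ok u r}"
      then obtain u r where z: "z = e u r" and "ok u r" by auto
      then show "z \<le> a"
        using mean_le[OF D, of a u] mean_nonneg[OF X const, of r] mean_nonneg[OF D w]
        by (auto simp: e_def ok_def)
    qed
    \<comment> \<open>A seed interrupts the growth before time \<open>r \<le> a\<close> with at most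
      this probability.\<close>
    show "1 - exp (- (l * a)) < 1" by simp
    have "ok u0 a"
      using u0 a v by (auto simp: ok_def profileD intro: add_increasing2)
    then show "e u0 a \<in> {e u r | u r. ok u r}" by auto
  next
    fix S z assume S: "0 \<le> S" and bound: "\<And>z. z \<in> {e u r | u r. ok u r} \<Longrightarrow> z \<le> S"
      and "z \<in> {e u r | u r. ok u r}"
    then obtain u r where z: "z = e u r" and ok: "ok u r" by auto
    then have r: "0 \<le> r" "r \<le> a" and u: "profile a u" by (auto simp: ok_def)
    note c = const[OF r]
    \<comment> \<open>Both means are expanded over the same first seed, arriving before or after
      time \<open>r\<close>.\<close>
    define F where "F = renewal D u"
    define F' where "F' = renewal {x} (\<lambda>_. r)"
    have F_bd: "\<bar>F t\<bar> \<le> 2 * a" "\<bar>F' t\<bar> \<le> 2 * a" for t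
      unfolding F_def F'_def by (rule renewal_bound[OF D u] renewal_bound[OF X c])+
    have [measurable]: "F \<in> borel_measurable borel" "F' \<in> borel_measurable borel"
      unfolding F_def F'_def by (rule renewal_measurable[OF D u] renewal_measurable[OF X c])+
    have int: "integrable (expo l) (\<lambda>t. indicator {..<r} t * G t)"
      if [measurable]: "G \<in> borel_measurable borel" and "\<And>t. \<bar>G t\<bar> \<le> 2 * a" for G :: "real \<Rightarrow> real"
      using that(2) a by (intro E.integrable_const_bound[of _ "2 * a"]) (auto simp: indicator_def)
    have intc: "integrable (expo l) (\<lambda>t. indicator {..<r} t * C)" for C :: real
      by (intro E.integrable_const_bound[of _ "\<bar>C\<bar>"]) (auto simp: indicator_def)
    have "mean D u = (\<integral>t. indicator {..<r} t * F t \<partial>expo l) +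
        exp (- (l * r)) * (min r (SUP s\<in>D. u s) + mean D (grow u r))"
      unfolding mean_eq_renewal[OF D u] integral_renewal_shift[OF D u r(1), symmetric] F_def[symmetric]
      by (rule integral_expo_split[OF l r(1) _ F_bd(1)]) measurable
    moreover have "mean {x} (\<lambda>_. r) = (\<integral>t. indicator {..<r} t * F' t \<partial>expo l) + exp (- (l * r)) * r"
    proof -
      have "mean {x} (\<lambda>_. r) = (\<integral>t. indicator {..<r} t * F' t \<partial>expo l) +
          exp (- (l * r)) * (min r (SUP s\<in>{x}. r) + mean {x} (grow (\<lambda>_. r) r))"
        unfolding mean_eq_renewal[OF X c] integral_renewal_shift[OF X c r(1), symmetric] F'_def[symmetric]
        by (rule integral_expo_split[OF l r(1) _ F_bd(2)]) measurable
      moreover have "grow (\<lambda>_. r) r = (\<lambda>_::'a. 0)"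
        by (simp add: grow_def fun_eq_iff)
      ultimately show ?thesis
        by (simp add: mean_zero[OF X])
    qed
    \<comment> \<open>No seed before \<open>r\<close>: by then at most \<open>r\<close> has elapsed
      and the configuration has caught up with \<open>w\<close>.\<close>
    moreover have "exp (- (l * r)) * (min r (SUP s\<in>D. u s) + mean D (grow u r)) \<le>
        exp (- (l * r)) * r + exp (- (l * r)) * mean D w"
    proof -
      have "mean D (grow u r) \<le> mean D w + 0"
      proof (rule mean_le_add[OF D profile_grow[OF u r(1)] w])
        fix s assume "s \<in> D"
        show "grow u r s \<le> w s + 0"
          using ok u0 v r(1) by (auto simp: ok_def w_def seed_def grow_def profileD) (smt (verit))+
      qed simp
      then show ?thesis
        by (simp flip: distrib_left)
    qed
    moreover have "(\<integral>t. indicator {..<r} t * F t \<partial>expo l) - (\<integral>t. indicator {..<r} t * F' t \<partial>expo l)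
        \<le> (\<integral>t. indicator {..<r} t * (S + mean D w) \<partial>expo l)"
    proof -
      have "F t \<le> F' t + (S + mean D w)" if t: "0 \<le> t" "t < r" for t
      proof -
        have "mean D (step u t y) \<le> mean {x} (step (\<lambda>_. r) t y) + (S + mean D w)" for y
        proof -
          \<comment> \<open>Either the old balls or the ball of the seed at \<open>y\<close> reach
            \<open>x\<close> first. A singleton sees only the value of the profile at
            \<open>x\<close>, so the stepped profile may be replaced by the constant
            \<open>r'\<close>.\<close>
          define r' where "r' = min (r - t) (dist y x / v)"
          have "mean {x} (step (\<lambda>_. r) t y) = mean {x} (\<lambda>_. r')"
            using t by (simp add: mean_def residual_time_def step_def seed_def grow_def r'_def)
          moreover have "ok (step u t y) r'"
            unfolding ok_def
          proof (intro conjI allI)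
            show "0 \<le> r'" "r' \<le> a" using t r v by (auto simp: r'_def)
            show "profile a (step u t y)" by (rule profile_step[OF u])
            fix s
            have us: "0 \<le> u s" "u s \<le> u0 s" "u s \<le> r + dist x s / v"
              using ok profileD(1)[OF u] by (auto simp: ok_def)
            have "step u t y s \<le> u s"
              using us t by (auto simp: step_def seed_def grow_def)
            with us show "step u t y s \<le> u0 s" by simp
            have nn: "0 \<le> dist x s / v" using v by simp
            \<comment> \<open>Once the ball around \<open>y\<close> has reached \<open>x\<close>, it
              grows at least as far as a ball started at \<open>x\<close> at that moment.\<close>
            have "dist y s / v \<le> dist y x / v + dist x s / v"
              using v dist_triangle[of y s x] by (simp add: divide_right_mono flip: add_divide_distrib)
            moreover have "step u t y s \<le> max 0 (u s - t)" "step u t y s \<le> dist y s / v"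
              using t by (auto simp: step_def seed_def grow_def)
            ultimately show "step u t y s \<le> r' + dist x s / v"
              using us t nn unfolding r'_def by linarith
          qed
          then have "e (step u t y) r' \<le> S"
            by (intro bound) auto
          ultimately show ?thesis by (simp add: e_def)
        qed
        then have "(\<integral>y. mean D (step u t y) \<partial>\<mu>) \<le> (\<integral>y. mean {x} (step (\<lambda>_. r) t y) + (S + mean D w) \<partial>\<mu>)"
          by (intro integral_mono integrable_mean_step[OF D u] integrable_mean_step[OF X c]
            Bochner_Integration.integrable_add \<mu>.integrable_const)
        also have "\<dots> = (\<integral>y. mean {x} (step (\<lambda>_. r) t y) \<partial>\<mu>) + (S + mean D w)"
          using \<mu>.prob_space by (simp add: integrable_mean_step[OF X c])
        finally show ?thesis
          using t by (simp add: F_def F'_def renewal_def)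
      qed
      then have "(\<integral>t. indicator {..<r} t * F t \<partial>expo l) \<le>
          (\<integral>t. indicator {..<r} t * F' t + indicator {..<r} t * (S + mean D w) \<partial>expo l)"
        using AE_expo_nonneg[of l]
        by (intro integral_mono_AE Bochner_Integration.integrable_add int intc F_bd)
          (auto simp: indicator_def)
      also have "\<dots> = (\<integral>t. indicator {..<r} t * F' t \<partial>expo l) + (\<integral>t. indicator {..<r} t * (S + mean D w) \<partial>expo l)"
        by (intro Bochner_Integration.integral_add int intc F_bd) auto
      finally show ?thesis by simp
    qed
    \<comment> \<open>The two cases have total weight 1, so \<open>mean D w\<close> cancels.\<close>
    ultimately have "z \<le> (S + mean D w) * (1 - exp (- (l * r))) + exp (- (l * r)) * mean D w - mean D w"
      unfolding z e_def integral_lessThan_const[OF r(1)] by linarith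
    also have "\<dots> = S * (1 - exp (- (l * r)))"
      by (simp add: algebra_simps)
    also have "\<dots> \<le> S * (1 - exp (- (l * a)))"
      using r l S by (intro mult_left_mono) auto
    finally show "z \<le> S * (1 - exp (- (l * a)))" .
  qed
  then show ?thesis by (simp add: e_def w_def)
qed

text \<open>By the renewal equation \<open>c * mean D u\<close> splits into \<open>c\<close> times
  the mean elapsed time, which pays for the error in \<open>integral_square_step_le\<close>, and
  \<open>c\<close> times the mean after the seed. The latter is passed on, so the excess
  \<open>e\<close> does not decrease on average in one step.\<close>

lemma variance_bound:
  assumes D: "countable D" "D \<noteq> {}" and u0: "profile a u0"
    and c: "\<And>x. mean {x} (\<lambda>_. a) \<le> c"
  shows "second_moment D u0 - (mean D u0)\<^sup>2 \<le> c * mean D u0"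
proof -
  have a: "0 \<le> a" by (rule profileD(3)[OF u0])
  have jump: "mean D u \<le> mean D (seed v u x) + c" if "profile a u" for u x
    using jump_bound[OF D that, of x] c[of x] by simp
  have c0: "0 \<le> c"
  proof -
    fix x :: 'a
    have "0 \<le> mean {x} (\<lambda>_. a)"
      using a by (intro mean_nonneg[of "{x}" a]) (auto simp: profile_def)
    with c[of x] show ?thesis by simp
  qed
  define e where "e = (\<lambda>u. second_moment D u - (mean D u)\<^sup>2 - c * mean D u)"
  have e_le: "e u \<le> a\<^sup>2" if "profile a u" for u
    using second_moment_bound[OF D that] mean_nonneg[OF D that] c0
    unfolding e_def by (smt (verit) mult_nonneg_nonneg zero_le_power2)
  have "e u0 \<le> 0"
  proof (rule contraction_bound)
    show "bdd_above {e u | u. profile a u}"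
      using e_le by (intro bdd_aboveI[of _ "a\<^sup>2"]) auto
    show "1 - exp (- (l * a)) < 1" by simp
    show "e u0 \<in> {e u | u. profile a u}" using u0 by auto
  next
    fix S z assume S: "0 \<le> S" and bound: "\<And>z. z \<in> {e u | u. profile a u} \<Longrightarrow> z \<le> S"
      and "z \<in> {e u | u. profile a u}"
    then obtain u where z: "z = e u" and u: "profile a u" by auto
    define m where "m = (\<lambda>t. min (max 0 t) (SUP s\<in>D. u s))"
    have m_bd: "0 \<le> m t" "m t \<le> a" for t
      using SUP_profile[OF D u] by (auto simp: m_def)
    have m_meas [measurable]: "m \<in> borel_measurable borel"
      unfolding m_def by measurable
    have meas2 [measurable]: "(\<lambda>p. mean D (step u (fst p) (snd p))) \<in> borel_measurable (expo l \<Otimes>\<^sub>M \<mu>)"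
      "(\<lambda>p. second_moment D (step u (fst p) (snd p))) \<in> borel_measurable (expo l \<Otimes>\<^sub>M \<mu>)"
      by (intro mean_step_measurable[OF D _ _ u]; measurable)+
    interpret P: pair_prob_space "expo l" \<mu> ..
    have bd: "\<bar>mean D (step u t x)\<bar> \<le> a" "\<bar>second_moment D (step u t x)\<bar> \<le> a\<^sup>2" for t x
      using mean_bound[OF D profile_step[OF u]] second_moment_bound[OF D profile_step[OF u]] by auto
    have bd_sq: "(mean D (step u t x))\<^sup>2 \<le> a\<^sup>2" for t x
      using power_mono[OF bd(1) abs_ge_zero, of t x 2] by simp
    have i1: "integrable (expo l \<Otimes>\<^sub>M \<mu>) (\<lambda>p. (m (fst p) + mean D (step u (fst p) (snd p)))\<^sup>2)"
    proof (rule P.P.integrable_const_bound[of _ "(2 * a)\<^sup>2"])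
      have "(m t + mean D (step u t x))\<^sup>2 \<le> (2 * a)\<^sup>2" for t x
        using m_bd[of t] mean_nonneg[OF D profile_step[OF u], of t x] mean_le[OF D profile_step[OF u], of t x]
        by (intro power_mono) auto
      then show "AE p in expo l \<Otimes>\<^sub>M \<mu>. norm ((m (fst p) + mean D (step u (fst p) (snd p)))\<^sup>2) \<le> (2 * a)\<^sup>2"
        by simp
    qed measurable
    have i2: "integrable (expo l \<Otimes>\<^sub>M \<mu>) (\<lambda>p. mean D (step u (fst p) (snd p)))"
      by (intro P.P.integrable_const_bound[of _ a]) (auto simp: bd)
    have i3: "integrable (expo l \<Otimes>\<^sub>M \<mu>) (\<lambda>p. second_moment D (step u (fst p) (snd p)))"
      by (intro P.P.integrable_const_bound[of _ "a\<^sup>2"]) (auto simp: bd)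
    have i4: "integrable (expo l \<Otimes>\<^sub>M \<mu>) (\<lambda>p. (mean D (step u (fst p) (snd p)))\<^sup>2)"
      by (intro P.P.integrable_const_bound[of _ "a\<^sup>2"]) (auto simp: bd_sq)
    have i5: "integrable (expo l \<Otimes>\<^sub>M \<mu>) (\<lambda>p. e (step u (fst p) (snd p)))"
      unfolding e_def using i2 i3 i4 by auto
    have int_m: "integrable (expo l) m"
      using m_bd by (intro E.integrable_const_bound[of _ a]) auto
    have "second_moment D u = (\<integral>p. (m (fst p) + mean D (step u (fst p) (snd p)))\<^sup>2 +
      (second_moment D (step u (fst p) (snd p)) - (mean D (step u (fst p) (snd p)))\<^sup>2) \<partial>(expo l \<Otimes>\<^sub>M \<mu>))"
      unfolding second_moment_eq[OF D u]
      by (subst P.integral_fst'[symmetric]) (use i1 i3 i4 in \<open>auto simp: m_def\<close>)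
    also have "\<dots> = (\<integral>p. (m (fst p) + mean D (step u (fst p) (snd p)))\<^sup>2 +
      (e (step u (fst p) (snd p)) + c * mean D (step u (fst p) (snd p))) \<partial>(expo l \<Otimes>\<^sub>M \<mu>))"
      by (simp add: e_def)
    also have "\<dots> = (\<integral>p. (m (fst p) + mean D (step u (fst p) (snd p)))\<^sup>2 \<partial>(expo l \<Otimes>\<^sub>M \<mu>)) +
      ((\<integral>p. e (step u (fst p) (snd p)) \<partial>(expo l \<Otimes>\<^sub>M \<mu>)) +
       c * (\<integral>p. mean D (step u (fst p) (snd p)) \<partial>(expo l \<Otimes>\<^sub>M \<mu>)))"
      using i1 i2 i5 by simp
    finally have second: "second_moment D u = (\<integral>p. (m (fst p) + mean D (step u (fst p) (snd p)))\<^sup>2 \<partial>(expo l \<Otimes>\<^sub>M \<mu>)) +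
      ((\<integral>p. e (step u (fst p) (snd p)) \<partial>(expo l \<Otimes>\<^sub>M \<mu>)) +
       c * (\<integral>p. mean D (step u (fst p) (snd p)) \<partial>(expo l \<Otimes>\<^sub>M \<mu>)))" .
    have "(\<integral>p. (m (fst p) + mean D (step u (fst p) (snd p)))\<^sup>2 \<partial>(expo l \<Otimes>\<^sub>M \<mu>)) \<le>
      (mean D u)\<^sup>2 + c * (\<integral>t. m t \<partial>expo l)"
      using integral_square_step_le[OF D u jump] P.integral_fst'[OF i1] by (simp add: m_def)
    moreover have "(\<integral>p. e (step u (fst p) (snd p)) \<partial>(expo l \<Otimes>\<^sub>M \<mu>)) \<le>
      (\<integral>t. indicator {..<a} t * S \<partial>expo l)"
    proof -
      \<comment> \<open>A seed at time \<open>a\<close> or later finds everything covered, since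
        \<open>u\<close> is bounded by \<open>a\<close>; then both moments vanish, and with them
        \<open>e\<close>.\<close>
      have le: "e (step u t x) \<le> indicator {..<a} t * S" if t: "0 \<le> t" for t x
      proof (cases "t < a")
        case True
        then show ?thesis
          using bound[of "e (step u t x)"] profile_step[OF u] by auto
      next
        case False
        have "step u t x s = 0" for s
          using t False profileD(2)[OF u, of s] v by (auto simp: step_def seed_def grow_def)
        then have "step u t x = (\<lambda>_. 0)" by auto
        then show ?thesis
          using False mean_zero[OF D] by (simp add: e_def)
      qed
      have "(\<integral>p. e (step u (fst p) (snd p)) \<partial>(expo l \<Otimes>\<^sub>M \<mu>)) = (\<integral>t. (\<integral>x. e (step u t x) \<partial>\<mu>) \<partial>expo l)"
        using P.integral_fst'[OF i5] by simp
      also have "\<dots> \<le> (\<integral>t. indicator {..<a} t * S \<partial>expo l)"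
      proof (rule integral_mono_AE)
        show "integrable (expo l) (\<lambda>t. \<integral>x. e (step u t x) \<partial>\<mu>)"
          using P.integrable_fst'[OF i5] by simp
        have "(\<integral>x. e (step u t x) \<partial>\<mu>) \<le> indicator {..<a} t * S" if "0 \<le> t" for t
        proof -
          have "integrable \<mu> (\<lambda>x. e (step u t x))"
            unfolding e_def
          proof (intro Bochner_Integration.integrable_diff integrable_mult_right integrable_mean_step[OF D u])
            show "integrable \<mu> (\<lambda>x. second_moment D (step u t x))"
              by (rule \<mu>.integrable_const_bound[of _ "a\<^sup>2"])
                (auto simp: bd intro!: mean_step_measurable[OF D _ _ u])
            show "integrable \<mu> (\<lambda>x. (mean D (step u t x))\<^sup>2)"
              by (rule \<mu>.integrable_const_bound[of _ "a\<^sup>2"])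
                (auto simp: bd_sq intro!: borel_measurable_power mean_step_measurable[OF D _ _ u])
          qed
          then have "(\<integral>x. e (step u t x) \<partial>\<mu>) \<le> (\<integral>x. indicator {..<a} t * S \<partial>\<mu>)"
            using le[OF that] by (intro integral_mono) auto
          then show ?thesis using \<mu>.prob_space by simp
        qed
        then show "AE t in expo l. (\<integral>x. e (step u t x) \<partial>\<mu>) \<le> indicator {..<a} t * S"
          using AE_expo_nonneg[of l] by auto
        show "integrable (expo l) (\<lambda>t. indicator {..<a} t * S)"
          using S by (intro E.integrable_const_bound[of _ S]) (auto simp: indicator_def)
      qed
      finally show ?thesis .
    qed
    moreover have "(\<integral>t. indicator {..<a} t * S \<partial>expo l) = S * (1 - exp (- (l * a)))"
      by (rule integral_lessThan_const[OF a])
    moreover have "mean D u = (\<integral>t. m t \<partial>expo l) + (\<integral>p. mean D (step u (fst p) (snd p)) \<partial>(expo l \<Otimes>\<^sub>M \<mu>))"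
    proof -
      have "mean D u = (\<integral>t. m t + (\<integral>x. mean D (step u t x) \<partial>\<mu>) \<partial>expo l)"
        unfolding mean_eq_renewal[OF D u] by (simp add: renewal_def[abs_def] m_def)
      also have "\<dots> = (\<integral>t. m t \<partial>expo l) + (\<integral>t. (\<integral>x. mean D (step u t x) \<partial>\<mu>) \<partial>expo l)"
        using P.integrable_fst'[OF i2] by (intro Bochner_Integration.integral_add int_m) simp
      finally show ?thesis
        using P.integral_fst'[OF i2] by simp
    qed
    then have "c * mean D u = c * (\<integral>t. m t \<partial>expo l) +
        c * (\<integral>p. mean D (step u (fst p) (snd p)) \<partial>(expo l \<Otimes>\<^sub>M \<mu>))"
      by (simp only: distrib_left)
    moreover have "z = second_moment D u - (mean D u)\<^sup>2 - c * mean D u"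
      by (simp add: z e_def)
    ultimately show "z \<le> S * (1 - exp (- (l * a)))"
      using second by linarith
  qed
  then show ?thesis by (simp add: e_def)
qed

end

section \<open>Distribution of the seeds\<close>

text \<open>Independence makes the joint law a product measure, whose image under
  \<open>to_stream\<close> is the stream space. \<open>N'\<close> supplies the sigma-algebra for
  \<open>indep_vars\<close>, \<open>N\<close> is the common law.\<close>

lemma (in prob_space) distr_to_stream_iid:
  assumes indep: "indep_vars (\<lambda>_. N') Y UNIV" and distr: "\<And>i. distr M N' (Y i) = N"
    and sets: "sets N = sets N'"
  shows "distr M (stream_space N) (\<lambda>w. to_stream (\<lambda>i. Y i w)) = stream_space N"
proof -
  have rv [measurable]: "Y i \<in> M \<rightarrow>\<^sub>M N'" for i
    using indep by (simp add: indep_vars_def)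
  have PiM_eq: "(\<Pi>\<^sub>M i\<in>UNIV. N) = distr M (\<Pi>\<^sub>M i\<in>(UNIV :: nat set). N') (\<lambda>w i. Y i w)"
    using indep_vars_iff_distr_eq_PiM[where I = UNIV and M' = "\<lambda>_. N'" and X = Y] indep distr rv by (simp add: restrict_UNIV)
  have [measurable]: "to_stream \<in> (\<Pi>\<^sub>M i\<in>UNIV. N') \<rightarrow>\<^sub>M stream_space N"
  proof -
    have "sets (\<Pi>\<^sub>M i\<in>UNIV. N) = sets (\<Pi>\<^sub>M i\<in>(UNIV :: nat set). N')"
      using sets by (intro sets_PiM_cong) auto
    then show ?thesis
      using measurable_to_stream[of N] by (simp cong: measurable_cong_sets)
  qed
  have "stream_space N = distr (\<Pi>\<^sub>M i\<in>UNIV. N) (stream_space N) to_stream"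
    by (rule stream_space_eq_distr)
  also have "\<dots> = distr M (stream_space N) (to_stream \<circ> (\<lambda>w i. Y i w))"
    unfolding PiM_eq by (rule distr_distr) (auto intro!: measurable_PiM_single' rv measurable_space[OF rv])
  finally show ?thesis by (simp add: comp_def)
qed

text \<open>Rectangles determine the joint law, so factorisation over preimages suffices; this is
  what independence of the generated sigma-algebras delivers.\<close>

lemma (in prob_space) distr_pair_indep_set:
  assumes f: "f \<in> M \<rightarrow>\<^sub>M N1" and g: "g \<in> M \<rightarrow>\<^sub>M N2"
    and indep: "\<And>A B. A \<in> sets N1 \<Longrightarrow> B \<in> sets N2 \<Longrightarrow>
      prob ((f -` A \<inter> space M) \<inter> (g -` B \<inter> space M)) = prob (f -` A \<inter> space M) * prob (g -` B \<inter> space M)"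
  shows "distr M (N1 \<Otimes>\<^sub>M N2) (\<lambda>w. (f w, g w)) = distr M N1 f \<Otimes>\<^sub>M distr M N2 g"
proof (rule pair_measure_eqI[symmetric])
  show "sigma_finite_measure (distr M N1 f)" "sigma_finite_measure (distr M N2 g)"
    by (intro finite_measure.axioms(1) prob_space.finite_measure prob_space_distr f g)+
  show "sets (distr M N1 f \<Otimes>\<^sub>M distr M N2 g) = sets (distr M (N1 \<Otimes>\<^sub>M N2) (\<lambda>w. (f w, g w)))"
    by (simp cong: sets_pair_measure_cong)
  fix A B assume "A \<in> sets (distr M N1 f)" "B \<in> sets (distr M N2 g)"
  then have A [measurable]: "A \<in> sets N1" and B [measurable]: "B \<in> sets N2" by auto
  note [measurable] = f g
  have "(\<lambda>w. (f w, g w)) -` (A \<times> B) \<inter> space M = (f -` A \<inter> space M) \<inter> (g -` B \<inter> space M)"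
    by auto
  then show "emeasure (distr M N1 f) A * emeasure (distr M N2 g) B =
      emeasure (distr M (N1 \<Otimes>\<^sub>M N2) (\<lambda>w. (f w, g w))) (A \<times> B)"
    by (simp add: emeasure_distr emeasure_eq_measure indep[OF A B] ennreal_mult)
qed

text \<open>If all arrivals stay at or below \<open>K\<close>, so do the first waiting time and all
  arrivals of the shifted stream. Hence the probability p of this event satisfies p \<le> p q, where
  q < 1 is the probability that one waiting time is at most \<open>K\<close>; so p = 0.\<close>

lemma (in growth) AE_arrival_unbounded:
  "AE w in stream_space (expo l). \<forall>n. \<exists>i. real n < arrival w i"
proof (subst AE_all_countable, rule)
  fix n
  have [measurable]: "(\<lambda>w. w !! j) \<in> borel_measurable (stream_space (expo l))" for j
  proof -
    have "(\<lambda>w. w !! j) \<in> stream_space (expo l) \<rightarrow>\<^sub>M expo l"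
      by measurable
    then show ?thesis
      by (simp cong: measurable_cong_sets)
  qed
  have [measurable]: "(\<lambda>w. arrival w i) \<in> borel_measurable (stream_space (expo l))" for i
    unfolding arrival_def by measurable
  define K where "K = real n"
  define A where "A = {w \<in> space (stream_space (expo l)). \<forall>i. arrival w i \<le> K}"
  have [measurable]: "A \<in> sets (stream_space (expo l))"
    unfolding A_def by measurable
  have "emeasure (stream_space (expo l)) A =
      (\<integral>\<^sup>+t. emeasure (stream_space (expo l)) {w \<in> space (stream_space (expo l)). t ## w \<in> A} \<partial>expo l)"
    by (rule E.emeasure_stream_space) measurable
  also have "\<dots> \<le> (\<integral>\<^sup>+t. emeasure (stream_space (expo l)) A * indicator {..K} t \<partial>expo l)"
  proof (rule nn_integral_mono)
    fix t
    have le: "t \<le> K" if "t ## w \<in> A" for w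
    proof -
      have "arrival (t ## w) 0 \<le> K"
        using that unfolding A_def by blast
      then show ?thesis by simp
    qed
    have "w \<in> A" if "t ## w \<in> A" for w
    proof -
      have "arrival w i \<le> K" for i
      proof -
        have "arrival (t ## w) (Suc i) \<le> K"
          using that unfolding A_def by blast
        then show ?thesis by simp
      qed
      then show ?thesis by (simp add: A_def space_stream_space)
    qed
    with le have "{w \<in> space (stream_space (expo l)). t ## w \<in> A} \<subseteq> (if t \<le> K then A else {})"
      by auto
    then have "emeasure (stream_space (expo l)) {w \<in> space (stream_space (expo l)). t ## w \<in> A}
        \<le> emeasure (stream_space (expo l)) (if t \<le> K then A else {})"
      by (rule emeasure_mono) auto
    then show "emeasure (stream_space (expo l)) {w \<in> space (stream_space (expo l)). t ## w \<in> A}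
        \<le> emeasure (stream_space (expo l)) A * indicator {..K} t"
      by (simp split: if_splits)
  qed
  also have "\<dots> = emeasure (stream_space (expo l)) A * emeasure (expo l) {..K}"
    by (simp add: nn_integral_cmult_indicator)
  also have "emeasure (expo l) {..K} = ennreal (1 - exp (- (l * K)))"
    using emeasure_erlang_density[OF l, of 0 K] by (simp add: erlang_CDF_0 K_def)
  finally have "SE.prob A \<le> SE.prob A * (1 - exp (- (l * K)))"
    using l by (simp add: SE.emeasure_eq_measure K_def flip: ennreal_mult)
  then have "SE.prob A = 0"
    by (simp add: algebra_simps mult_le_0_iff measure_le_0_iff)
  then have "AE w in stream_space (expo l). w \<notin> A"
    by (intro AE_not_in null_setsI) (auto simp: SE.emeasure_eq_measure)
  then show "AE w in stream_space (expo l). \<exists>i. real n < arrival w i"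
    by (rule AE_mp) (auto intro!: AE_I2 simp: A_def K_def not_le)
qed

section \<open>Cover times as suprema and infima\<close>

text \<open>\<open>D\<close> is the union of finite nets of radius
  \<open>inverse (real (Suc n))\<close>, which total boundedness provides.\<close>

lemma countable_dense_compact:
  assumes "compact (UNIV :: 'a::metric_space set)"
  obtains D :: "'a::metric_space set" where "countable D" "D \<noteq> {}" "\<And>x e. 0 < e \<Longrightarrow> \<exists>d\<in>D. dist x d < e"
proof -
  have "\<exists>k. finite k \<and> (UNIV :: 'a set) \<subseteq> (\<Union>x\<in>k. ball x (inverse (real (Suc n))))" for n
  proof -
    have "\<forall>e>0. \<exists>k. finite k \<and> (UNIV :: 'a set) \<subseteq> (\<Union>x\<in>k. ball x e)"
      using assms unfolding compact_eq_totally_bounded by blast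
    then show ?thesis by simp
  qed
  then obtain k :: "nat \<Rightarrow> 'a set" where k: "\<And>n. finite (k n)"
    "\<And>n. UNIV \<subseteq> (\<Union>x\<in>k n. ball x (inverse (real (Suc n))))"
    by metis
  have dense: "\<exists>d\<in>\<Union>(range k). dist x d < e" if "0 < e" for x e
  proof -
    obtain n where "inverse (real (Suc n)) < e"
      using reals_Archimedean \<open>0 < e\<close> by blast
    moreover have "x \<in> (\<Union>d\<in>k n. ball d (inverse (real (Suc n))))"
      using k(2)[of n] by blast
    then obtain d where "d \<in> k n" "dist d x < inverse (real (Suc n))"
      unfolding UN_iff mem_ball by blast
    ultimately show ?thesis
      by (intro bexI[of _ d]) (auto simp: dist_commute)
  qed
  show thesis
  proof (rule that[of "\<Union>(range k)"])
    have "\<exists>d\<in>\<Union>(range k). dist undefined d < 1"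
      by (rule dense) simp
    then show "\<Union>(range k) \<noteq> {}"
      by (metis empty_iff)
    show "countable (\<Union>(range k))"
      using k(1) by (auto intro: countable_finite)
  qed (rule dense)
qed

text \<open>This reduces the supremum over all points to a countable one, which is
  measurable.\<close>

lemma SUP_dense_eq:
  fixes f :: "'a::metric_space \<Rightarrow> real"
  assumes D: "D \<noteq> {}" "\<And>x e. 0 < e \<Longrightarrow> \<exists>d\<in>D. dist x d < e"
    and f: "\<And>x y. f x \<le> f y + K * dist x y" and bdd: "bdd_above (range f)"
  shows "(SUP x\<in>D. f x) = (SUP x. f x)"
proof (rule antisym)
  show "(SUP x\<in>D. f x) \<le> (SUP x. f x)"
    using D(1) bdd by (intro cSUP_subset_mono) auto
  have bddD: "bdd_above (f ` D)"
    using bdd by (rule bdd_above_mono) auto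
  show "(SUP x. f x) \<le> (SUP x\<in>D. f x)"
  proof (rule cSUP_least)
    fix x
    show "f x \<le> (SUP x\<in>D. f x)"
    proof (rule field_le_epsilon)
      fix e :: real assume e: "0 < e"
      \<comment> \<open>The denominator is positive whatever the sign of \<open>K\<close>.\<close>
      obtain d where d: "d \<in> D" "dist x d < e / (\<bar>K\<bar> + 1)"
        using D(2)[of "e / (\<bar>K\<bar> + 1)" x] e by auto
      have "K * dist x d \<le> (\<bar>K\<bar> + 1) * dist x d"
        by (intro mult_right_mono) auto
      also have "\<dots> \<le> e"
        using d(2) by (simp add: field_simps)
      finally show "f x \<le> (SUP x\<in>D. f x) + e"
        using f[of x d] cSUP_upper[OF d(1) bddD] by linarith
    qed
  qed simp
qed

context
  fixes v :: real
  assumes v: "0 < v"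
begin

text \<open>A distance of at most \<open>v * (t - \<tau> i \<omega>)\<close> forces
  \<open>\<tau> i \<omega> \<le> t\<close>, so both conditions merge into one; \<open>max 0\<close>
  encodes \<open>0 \<le> t\<close>.\<close>

lemma point_covering_times_eq:
  "point_covering_times v \<tau> \<sigma> s \<omega> = {t. \<exists>i. max 0 (\<tau> i \<omega> + dist (\<sigma> i \<omega>) s / v) \<le> t}"
proof -
  have "(\<tau> i \<omega> \<le> t \<and> dist (\<sigma> i \<omega>) s \<le> v * (t - \<tau> i \<omega>)) \<longleftrightarrow> \<tau> i \<omega> + dist (\<sigma> i \<omega>) s / v \<le> t" for i t
  proof -
    have "dist (\<sigma> i \<omega>) s \<le> v * (t - \<tau> i \<omega>) \<longleftrightarrow> dist (\<sigma> i \<omega>) s / v \<le> t - \<tau> i \<omega>"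
      using v by (simp add: pos_divide_le_eq mult.commute)
    moreover have "0 \<le> dist (\<sigma> i \<omega>) s / v" using v by simp
    ultimately show ?thesis by linarith
  qed
  then show ?thesis
    by (auto simp: point_covering_times_def grown_set_def)
qed

lemma bdd_below_reach: "bdd_below (range (\<lambda>i. max 0 (\<tau> i \<omega> + dist (\<sigma> i \<omega>) s / v)))"
  by (intro bdd_belowI[of _ 0]) auto

lemma point_cover_time_eq:
  "point_cover_time v \<tau> \<sigma> s \<omega> = (INF i. max 0 (\<tau> i \<omega> + dist (\<sigma> i \<omega>) s / v))"
  unfolding point_cover_time_def point_covering_times_eq
proof (rule antisym)
  let ?f = "\<lambda>i. max 0 (\<tau> i \<omega> + dist (\<sigma> i \<omega>) s / v)"
  have "bdd_below {t. \<exists>i. ?f i \<le> t}"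
    by (intro bdd_belowI[of _ 0]) auto
  then show "Inf {t. \<exists>i. ?f i \<le> t} \<le> (INF i. ?f i)"
    by (intro cINF_greatest cInf_lower) blast+
  have "(INF i. ?f i) \<le> t" if "?f i \<le> t" for i t
    using cINF_lower[OF bdd_below_reach, of i \<tau> \<omega> \<sigma> s] that by auto
  then show "(INF i. ?f i) \<le> Inf {t. \<exists>i. ?f i \<le> t}"
    by (intro cInf_greatest) blast+
qed

lemma point_cover_time_nonneg: "0 \<le> point_cover_time v \<tau> \<sigma> s \<omega>"
  unfolding point_cover_time_eq by (intro cINF_greatest) auto

lemma point_cover_time_lipschitz:
  "point_cover_time v \<tau> \<sigma> s \<omega> \<le> point_cover_time v \<tau> \<sigma> s' \<omega> + 1 / v * dist s s'"
proof -
  have "point_cover_time v \<tau> \<sigma> s \<omega> - 1 / v * dist s s' \<le> point_cover_time v \<tau> \<sigma> s' \<omega>"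
    unfolding point_cover_time_eq[of _ _ s']
  proof (rule cINF_greatest)
    fix i
    have "point_cover_time v \<tau> \<sigma> s \<omega> \<le> max 0 (\<tau> i \<omega> + dist (\<sigma> i \<omega>) s / v)"
      unfolding point_cover_time_eq by (intro cINF_lower bdd_below_reach) auto
    moreover have "dist (\<sigma> i \<omega>) s / v \<le> (dist (\<sigma> i \<omega>) s' + dist s s') / v"
      using v by (intro divide_right_mono) (metis dist_commute dist_triangle, simp)
    moreover have "0 \<le> dist s s' / v" using v by simp
    ultimately show "point_cover_time v \<tau> \<sigma> s \<omega> - 1 / v * dist s s' \<le> max 0 (\<tau> i \<omega> + dist (\<sigma> i \<omega>) s' / v)"
      by (simp add: add_divide_distrib)
  qed simp
  then show ?thesis by simp
qed

lemma covering_times_eq: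
  "covering_times v \<tau> \<sigma> \<omega> = {t. \<forall>s. t \<in> point_covering_times v \<tau> \<sigma> s \<omega>}"
  by (auto simp: covering_times_def point_covering_times_def)

lemma point_covering_times_upward:
  "t \<in> point_covering_times v \<tau> \<sigma> s \<omega> \<Longrightarrow> t \<le> t' \<Longrightarrow> t' \<in> point_covering_times v \<tau> \<sigma> s \<omega>"
  unfolding point_covering_times_eq by (auto intro: order_trans)

lemma point_cover_time_less:
  "point_cover_time v \<tau> \<sigma> s \<omega> < t \<Longrightarrow> t \<in> point_covering_times v \<tau> \<sigma> s \<omega>"
  unfolding point_cover_time_eq point_covering_times_eq
  by (subst (asm) cINF_less_iff) (auto intro: bdd_below_reach less_imp_le)

lemma point_cover_time_le:
  "t \<in> point_covering_times v \<tau> \<sigma> s \<omega> \<Longrightarrow> point_cover_time v \<tau> \<sigma> s \<omega> \<le> t"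
  unfolding point_cover_time_eq point_covering_times_eq
  by (auto intro: order_trans[OF cINF_lower[OF bdd_below_reach]])

text \<open>Only seeds that have arrived shortly after the infimum can compete for it, and these are
  finitely many.\<close>

lemma point_cover_time_attained:
  assumes unb: "\<And>K. finite {i. \<tau> i \<omega> \<le> K}"
  shows "point_cover_time v \<tau> \<sigma> s \<omega> \<in> point_covering_times v \<tau> \<sigma> s \<omega>"
proof -
  let ?f = "\<lambda>i. max 0 (\<tau> i \<omega> + dist (\<sigma> i \<omega>) s / v)"
  define m where "m = point_cover_time v \<tau> \<sigma> s \<omega>"
  \<comment> \<open>The margin 1 makes \<open>I\<close> nonempty before the infimum is known to be
    attained.\<close>
  define I where "I = {i. ?f i \<le> m + 1}"
  have "\<tau> i \<omega> \<le> m + 1" if "?f i \<le> m + 1" for i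
  proof -
    have "0 \<le> dist (\<sigma> i \<omega>) s / v" using v by simp
    with that show ?thesis by linarith
  qed
  then have "I \<subseteq> {i. \<tau> i \<omega> \<le> m + 1}"
    by (auto simp: I_def simp del: max.bounded_iff)
  then have fin: "finite I"
    using unb finite_subset by blast
  have "m + 1 \<in> point_covering_times v \<tau> \<sigma> s \<omega>"
    by (rule point_cover_time_less) (simp add: m_def)
  then have "I \<noteq> {}"
    unfolding point_covering_times_eq I_def by auto
  then obtain j where j: "j \<in> I" "\<And>i. i \<in> I \<Longrightarrow> ?f j \<le> ?f i"
    using fin arg_min_if_finite[of I ?f] by (metis (no_types, lifting) linorder_not_less)
  have "?f j \<le> (INF i. ?f i)"
  proof (rule cINF_greatest)
    fix i
    show "?f j \<le> ?f i"
    proof (cases "i \<in> I")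
      case False
      then have "m + 1 < ?f i" by (simp add: I_def not_le del: max.bounded_iff)
      moreover have "?f j \<le> m + 1" using j(1) by (simp add: I_def)
      ultimately show ?thesis by linarith
    qed (rule j(2))
  qed simp
  then show ?thesis
    unfolding point_covering_times_eq point_cover_time_eq by blast
qed

section \<open>Consequences of a bounded diameter\<close>

context
  fixes B :: real
  assumes B: "\<And>x y :: 'a::metric_space. dist x y \<le> B"
begin

text \<open>The first seed alone covers the whole space within time \<open>B / v\<close> of its
  arrival.\<close>

lemma point_cover_time_upper:
  fixes \<sigma> :: "nat \<Rightarrow> 'w \<Rightarrow> 'a::metric_space"
  shows "point_cover_time v \<tau> \<sigma> s \<omega> \<le> max 0 (\<tau> 0 \<omega> + B / v)"
proof -
  have "point_cover_time v \<tau> \<sigma> s \<omega> \<le> max 0 (\<tau> 0 \<omega> + dist (\<sigma> 0 \<omega>) s / v)"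
    unfolding point_cover_time_eq by (intro cINF_lower bdd_below_reach) auto
  also have "\<dots> \<le> max 0 (\<tau> 0 \<omega> + B / v)"
    using v B by (intro max.mono add_left_mono divide_right_mono) auto
  finally show ?thesis .
qed

lemma bdd_above_point_cover_time:
  fixes \<sigma> :: "nat \<Rightarrow> 'w \<Rightarrow> 'a::metric_space"
  shows "bdd_above (range (\<lambda>s. point_cover_time v \<tau> \<sigma> s \<omega>))"
  using point_cover_time_upper by (intro bdd_aboveI[of _ "max 0 (\<tau> 0 \<omega> + B / v)"]) auto

text \<open>Every time strictly above all point cover times is a covering time, which is enough for
  the infimum. The identity therefore holds for every sample, also where minima are not
  attained.\<close>

lemma cover_time_eq:
  fixes \<sigma> :: "nat \<Rightarrow> 'w \<Rightarrow> 'a::metric_space"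
  shows "cover_time v \<tau> \<sigma> \<omega> = (SUP s. point_cover_time v \<tau> \<sigma> s \<omega>)"
  unfolding cover_time_def
proof (rule antisym)
  show "Inf (covering_times v \<tau> \<sigma> \<omega>) \<le> (SUP s. point_cover_time v \<tau> \<sigma> s \<omega>)"
  proof (rule dense_ge)
    fix t assume t: "(SUP s. point_cover_time v \<tau> \<sigma> s \<omega>) < t"
    have "point_cover_time v \<tau> \<sigma> s \<omega> < t" for s
      using t by (rule le_less_trans[rotated]) (intro cSUP_upper bdd_above_point_cover_time UNIV_I)
    then have "t \<in> point_covering_times v \<tau> \<sigma> s \<omega>" for s
      by (rule point_cover_time_less)
    then show "Inf (covering_times v \<tau> \<sigma> \<omega>) \<le> t"
      unfolding covering_times_eq
      by (intro cInf_lower bdd_belowI[of _ 0]) (auto simp: point_covering_times_def)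
  qed
  have "(SUP s. point_cover_time v \<tau> \<sigma> s \<omega>) + 1 \<in> covering_times v \<tau> \<sigma> \<omega>"
    unfolding covering_times_eq
    by (auto intro!: point_cover_time_less le_less_trans[OF cSUP_upper[OF _ bdd_above_point_cover_time]])
  then show "(SUP s. point_cover_time v \<tau> \<sigma> s \<omega>) \<le> Inf (covering_times v \<tau> \<sigma> \<omega>)"
    by (intro cInf_greatest cSUP_least) (auto simp: covering_times_eq intro: point_cover_time_le)
qed

lemma point_cover_time_le_cover_time:
  fixes \<sigma> :: "nat \<Rightarrow> 'w \<Rightarrow> 'a::metric_space"
  shows "point_cover_time v \<tau> \<sigma> s \<omega> \<le> cover_time v \<tau> \<sigma> \<omega>"
  unfolding cover_time_eq by (intro cSUP_upper bdd_above_point_cover_time) auto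

text \<open>Each set of point covering times contains its infimum and is upward closed, hence
  contains the cover time.\<close>

lemma cover_time_attained:
  fixes \<sigma> :: "nat \<Rightarrow> 'w \<Rightarrow> 'a::metric_space"
  assumes "\<And>K. finite {i. \<tau> i \<omega> \<le> K}"
  shows "cover_time v \<tau> \<sigma> \<omega> \<in> covering_times v \<tau> \<sigma> \<omega>"
  unfolding covering_times_eq
  using point_covering_times_upward[OF point_cover_time_attained[where \<tau> = \<tau>, OF assms] point_cover_time_le_cover_time]
  by blast

lemma cover_time_le:
  fixes \<sigma> :: "nat \<Rightarrow> 'w \<Rightarrow> 'a::metric_space"
  shows "t \<in> covering_times v \<tau> \<sigma> \<omega> \<Longrightarrow> cover_time v \<tau> \<sigma> \<omega> \<le> t"
  unfolding cover_time_eq by (intro cSUP_least) (auto simp: covering_times_eq intro: point_cover_time_le)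

lemma cover_time_bounds:
  fixes \<sigma> :: "nat \<Rightarrow> 'w \<Rightarrow> 'a::metric_space"
  shows "0 \<le> cover_time v \<tau> \<sigma> \<omega>" "cover_time v \<tau> \<sigma> \<omega> \<le> max 0 (\<tau> 0 \<omega> + B / v)"
proof -
  show "cover_time v \<tau> \<sigma> \<omega> \<le> max 0 (\<tau> 0 \<omega> + B / v)"
    unfolding cover_time_eq by (intro cSUP_least point_cover_time_upper) auto
  show "0 \<le> cover_time v \<tau> \<sigma> \<omega>"
    using point_cover_time_nonneg point_cover_time_le_cover_time by (rule order_trans)
qed

end

end

section \<open>The growth process\<close>

lemma sum_gap: "(\<Sum>j\<le>i. gap \<tau> j \<omega>) = \<tau> i \<omega>"
  by (induction i) (auto simp: gap_def)

lemma snth_to_stream: "to_stream f !! i = f i"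
  by (simp add: to_stream_def)

locale growth_process = growth l v \<mu> + P: prob_space M
  for l v :: real and \<mu> :: "'a::metric_space measure" and M :: "'w measure" +
  fixes \<tau> :: "nat \<Rightarrow> 'w \<Rightarrow> real" and \<sigma> :: "nat \<Rightarrow> 'w \<Rightarrow> 'a"
  assumes compact: "compact (UNIV :: 'a set)"
    and poisson: "poisson_times M l \<tau>" and iid: "iid_points M \<mu> \<sigma>"
    and indep: "indep_sequences M \<tau> \<sigma>"
begin

definition sample :: "'w \<Rightarrow> real stream \<times> 'a stream" where
  "sample \<omega> = (to_stream (\<lambda>i. gap \<tau> i \<omega>), to_stream (\<lambda>i. \<sigma> i \<omega>))"

lemma gap_distributed: "distributed M lborel (gap \<tau> i) (exponential_density l)"
  using poisson by (simp add: poisson_times_def)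

lemma gap_measurable [measurable]: "gap \<tau> i \<in> borel_measurable M"
  using distributed_measurable[OF gap_distributed] by simp

lemma \<tau>_measurable [measurable]: "\<tau> i \<in> borel_measurable M"
proof -
  have "(\<lambda>\<omega>. \<Sum>j\<le>i. gap \<tau> j \<omega>) \<in> borel_measurable M"
    by measurable
  then show ?thesis by (simp add: sum_gap)
qed

lemma \<sigma>_measurable [measurable]: "\<sigma> i \<in> M \<rightarrow>\<^sub>M borel"
  using iid by (simp add: iid_points_def P.indep_vars_def)

lemma distr_gap: "distr M (stream_space (expo l)) (\<lambda>\<omega>. to_stream (\<lambda>i. gap \<tau> i \<omega>)) = stream_space (expo l)"
proof (rule P.distr_to_stream_iid[where N' = borel])
  show "P.indep_vars (\<lambda>_. borel) (gap \<tau>) UNIV"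
    using poisson by (simp add: poisson_times_def)
  show "distr M borel (gap \<tau> i) = expo l" for i
  proof -
    have "distr M borel (gap \<tau> i) = distr M lborel (gap \<tau> i)"
      by (rule distr_cong) auto
    then show ?thesis
      by (simp only: distributed_distr_eq_density[OF gap_distributed])
  qed
qed simp

lemma distr_\<sigma>: "distr M (stream_space \<mu>) (\<lambda>\<omega>. to_stream (\<lambda>i. \<sigma> i \<omega>)) = stream_space \<mu>"
  using iid by (intro P.distr_to_stream_iid[where N' = borel]) (auto simp: iid_points_def sets_\<mu>)

lemma gap_stream_measurable [measurable]:
  "(\<lambda>\<omega>. to_stream (\<lambda>i. gap \<tau> i \<omega>)) \<in> M \<rightarrow>\<^sub>M stream_space (expo l)"
  by (rule measurable_stream_space2) (simp add: snth_to_stream cong: measurable_cong_sets)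

lemma \<sigma>_stream_measurable [measurable]:
  "(\<lambda>\<omega>. to_stream (\<lambda>i. \<sigma> i \<omega>)) \<in> M \<rightarrow>\<^sub>M stream_space \<mu>"
  using \<sigma>_measurable measurable_cong_sets[OF refl sets_\<mu>, of M]
  by (intro measurable_stream_space2) (auto simp add: snth_to_stream)

lemma sample_measurable [measurable]: "sample \<in> M \<rightarrow>\<^sub>M seeds"
  unfolding sample_def by measurable

text \<open>Independence is given for the sigma-algebras of \<open>\<tau>\<close> and
  \<open>\<sigma>\<close>. The gaps are functions of \<open>\<tau>\<close>, so their stream is
  measurable for the former and the product law follows.\<close>

lemma distr_sample: "distr M seeds sample = seeds"
proof -
  let ?f = "\<lambda>\<omega>. to_stream (\<lambda>i. gap \<tau> i \<omega>)" and ?g = "\<lambda>\<omega>. to_stream (\<lambda>i. \<sigma> i \<omega>)"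
  let ?S = "vimage_algebra (space M) (\<lambda>\<omega> i. \<tau> i \<omega>) (\<Pi>\<^sub>M i\<in>(UNIV :: nat set). (borel :: real measure))"
  let ?T = "vimage_algebra (space M) (\<lambda>\<omega> i. \<sigma> i \<omega>) (\<Pi>\<^sub>M i\<in>(UNIV :: nat set). (borel :: 'a measure))"
  have coord: "(\<lambda>\<omega>. \<tau> i \<omega>) \<in> ?S \<rightarrow>\<^sub>M borel" for i
  proof -
    have "(\<lambda>\<omega> i. \<tau> i \<omega>) \<in> ?S \<rightarrow>\<^sub>M (\<Pi>\<^sub>M i\<in>(UNIV :: nat set). borel)"
      by (rule measurable_vimage_algebra1) (auto simp: space_PiM)
    then show ?thesis
      by (rule measurable_compose) simp
  qed
  have coord': "(\<lambda>\<omega>. \<sigma> i \<omega>) \<in> ?T \<rightarrow>\<^sub>M \<mu>" for i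
  proof -
    have "(\<lambda>\<omega> i. \<sigma> i \<omega>) \<in> ?T \<rightarrow>\<^sub>M (\<Pi>\<^sub>M i\<in>(UNIV :: nat set). borel)"
      by (rule measurable_vimage_algebra1) (auto simp: space_PiM)
    then have "(\<lambda>\<omega>. \<sigma> i \<omega>) \<in> ?T \<rightarrow>\<^sub>M borel"
      by (rule measurable_compose) simp
    then show ?thesis
      using measurable_cong_sets[OF refl sets_\<mu>, of ?T] by blast
  qed
  have fS: "?f \<in> ?S \<rightarrow>\<^sub>M stream_space (expo l)"
  proof (rule measurable_stream_space2)
    fix n
    have "(\<lambda>\<omega>. gap \<tau> n \<omega>) \<in> borel_measurable ?S"
      unfolding gap_def using coord by (cases n) auto
    then show "(\<lambda>\<omega>. ?f \<omega> !! n) \<in> ?S \<rightarrow>\<^sub>M expo l"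
      by (simp add: snth_to_stream cong: measurable_cong_sets)
  qed
  have gT: "?g \<in> ?T \<rightarrow>\<^sub>M stream_space \<mu>"
    using coord' by (intro measurable_stream_space2) (simp add: snth_to_stream)
  have "distr M seeds sample = distr M (stream_space (expo l)) ?f \<Otimes>\<^sub>M distr M (stream_space \<mu>) ?g"
    unfolding sample_def
  proof (rule P.distr_pair_indep_set[OF gap_stream_measurable \<sigma>_stream_measurable])
    fix A B assume "A \<in> sets (stream_space (expo l))" "B \<in> sets (stream_space \<mu>)"
    then have "?f -` A \<inter> space M \<in> sets ?S" "?g -` B \<inter> space M \<in> sets ?T"
      using measurable_sets[OF fS] measurable_sets[OF gT] by auto
    then show "P.prob ((?f -` A \<inter> space M) \<inter> (?g -` B \<inter> space M)) =
        P.prob (?f -` A \<inter> space M) * P.prob (?g -` B \<inter> space M)"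
      using indep unfolding indep_sequences_def by (intro P.indep_setD)
  qed
  then show ?thesis
    by (simp only: distr_gap distr_\<sigma>)
qed

lemma AE_gap_nonneg: "AE \<omega> in M. \<forall>i. 0 \<le> gap \<tau> i \<omega>"
proof (subst AE_all_countable, rule)
  fix i
  have "AE x in distr M lborel (gap \<tau> i). 0 \<le> x"
    unfolding distributed_distr_eq_density[OF gap_distributed] by (rule AE_expo_nonneg)
  then show "AE \<omega> in M. 0 \<le> gap \<tau> i \<omega>"
    by (subst (asm) AE_distr_iff) auto
qed

lemma arrival_sample:
  assumes "\<forall>i. 0 \<le> gap \<tau> i \<omega>"
  shows "arrival (fst (sample \<omega>)) i = \<tau> i \<omega>"
proof -
  have "arrival (fst (sample \<omega>)) i = (\<Sum>j\<le>i. gap \<tau> j \<omega>)"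
    unfolding arrival_def sample_def using assms by (simp add: snth_to_stream max_absorb2)
  then show ?thesis by (simp add: sum_gap)
qed

text \<open>With nonnegative gaps neither cut-off at 0 acts, and the two infima agree term by
  term.\<close>

lemma hit_sample:
  assumes "\<forall>i. 0 \<le> gap \<tau> i \<omega>"
  shows "hit v (sample \<omega>) s = point_cover_time v \<tau> \<sigma> s \<omega>"
proof -
  have "arrival (fst (sample \<omega>)) i + dist (snd (sample \<omega>) !! i) s / v =
      max 0 (\<tau> i \<omega> + dist (\<sigma> i \<omega>) s / v)" for i
    using arrival_nonneg[of "fst (sample \<omega>)" i] v
    by (simp add: arrival_sample[OF assms]) (simp add: sample_def snth_to_stream)
  then show ?thesis
    by (simp add: hit_def point_cover_time_eq[OF v])
qed

text \<open>Nonnegative gaps make the arrivals monotone, so a single arrival beyond \<open>K\<close>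
  suffices; it comes from the canonical space.\<close>

lemma AE_arrivals_finite: "AE \<omega> in M. \<forall>K. finite {i. \<tau> i \<omega> \<le> K}"
proof -
  have "AE w in distr M (stream_space (expo l)) (\<lambda>\<omega>. to_stream (\<lambda>i. gap \<tau> i \<omega>)). \<forall>n. \<exists>i. real n < arrival w i"
    unfolding distr_gap by (rule AE_arrival_unbounded)
  then have "AE \<omega> in M. \<forall>n. \<exists>i. real n < arrival (fst (sample \<omega>)) i"
    unfolding sample_def fst_conv by (rule AE_distrD[rotated]) measurable
  with AE_gap_nonneg show ?thesis
  proof eventually_elim
    fix \<omega> assume nn: "\<forall>i. 0 \<le> gap \<tau> i \<omega>" and unb: "\<forall>n. \<exists>i. real n < arrival (fst (sample \<omega>)) i"
    have mono: "\<tau> i \<omega> \<le> \<tau> j \<omega>" if "i \<le> j" for i j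
      using sum_mono2[of "{..j}" "{..i}" "\<lambda>k. gap \<tau> k \<omega>"] that nn by (simp add: sum_gap)
    show "\<forall>K. finite {i. \<tau> i \<omega> \<le> K}"
    proof
      fix K
      obtain n where "K \<le> real n" using real_arch_simple by blast
      moreover obtain i where "real n < \<tau> i \<omega>"
        using unb arrival_sample[OF nn] by auto
      ultimately have "{j. \<tau> j \<omega> \<le> K} \<subseteq> {..<i}"
        using mono by (auto simp: not_le[symmetric]) (meson order_trans not_le less_imp_le)
      then show "finite {i. \<tau> i \<omega> \<le> K}"
        by (rule finite_subset) simp
    qed
  qed
qed


section \<open>Measurability, integrability and the maximal mean\<close>

lemma dist_bounded: obtains B where "0 \<le> B" "\<And>x y :: 'a. dist x y \<le> B"
proof -
  obtain B where B: "\<And>x y :: 'a. dist x y \<le> B"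
    using compact_imp_bounded[OF compact] bounded_two_points[of "UNIV :: 'a set"] by auto
  moreover have "0 \<le> B"
    using B[of undefined undefined] by simp
  ultimately show thesis by (rule that[rotated])
qed

lemma point_cover_time_measurable [measurable]: "point_cover_time v \<tau> \<sigma> s \<in> borel_measurable M"
proof -
  have [measurable]: "(\<lambda>\<omega>. dist (\<sigma> i \<omega>) s) \<in> borel_measurable M" for i
    by (rule measurable_compose[OF \<sigma>_measurable])
      (intro borel_measurable_continuous_onI continuous_intros)
  show ?thesis
    unfolding point_cover_time_eq[OF v, abs_def] by measurable
qed

lemma cover_time_SUP_dense:
  assumes "D \<noteq> {}" "\<And>x e. 0 < e \<Longrightarrow> \<exists>d\<in>D. dist x d < e"
  shows "cover_time v \<tau> \<sigma> \<omega> = (SUP s\<in>D. point_cover_time v \<tau> \<sigma> s \<omega>)"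
proof -
  obtain B where B: "0 \<le> B" "\<And>x y :: 'a. dist x y \<le> B"
    using dist_bounded by blast
  show ?thesis
    unfolding cover_time_eq[OF v B(2)]
    by (rule SUP_dense_eq[symmetric, where K = "1 / v"])
      (use assms in \<open>auto intro: point_cover_time_lipschitz[OF v, simplified] bdd_above_point_cover_time[OF v B(2)]\<close>)
qed

lemma cover_time_measurable [measurable]: "cover_time v \<tau> \<sigma> \<in> borel_measurable M"
proof -
  obtain B where B: "0 \<le> B" "\<And>x y :: 'a. dist x y \<le> B"
    using dist_bounded by blast
  obtain D :: "'a set" where D: "countable D" "D \<noteq> {}" "\<And>x e. 0 < e \<Longrightarrow> \<exists>d\<in>D. dist x d < e"
    using countable_dense_compact[OF compact] by blast
  have "(\<lambda>\<omega>. SUP s\<in>D. point_cover_time v \<tau> \<sigma> s \<omega>) \<in> borel_measurable M"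
  proof (rule borel_measurable_cSUP[OF D(1)])
    show "bdd_above ((\<lambda>s. point_cover_time v \<tau> \<sigma> s \<omega>) ` D)" for \<omega>
      using bdd_above_point_cover_time[OF v B(2)] by (rule bdd_above_mono) auto
  qed measurable
  moreover have "cover_time v \<tau> \<sigma> = (\<lambda>\<omega>. SUP s\<in>D. point_cover_time v \<tau> \<sigma> s \<omega>)"
    by (rule ext, rule cover_time_SUP_dense[OF D(2,3)])
  ultimately show ?thesis by simp
qed

text \<open>The cover time is dominated by the first arrival plus \<open>B / v\<close>, and an
  exponential variable has all moments.\<close>

lemma integrable_cover_time_power:
  "integrable M (cover_time v \<tau> \<sigma>)" "integrable M (\<lambda>\<omega>. (cover_time v \<tau> \<sigma> \<omega>)\<^sup>2)"
proof -
  obtain B where B: "0 \<le> B" "\<And>x y :: 'a. dist x y \<le> B"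
    using dist_bounded by blast
  have \<tau>0: "gap \<tau> 0 = \<tau> 0"
    by (simp add: gap_def fun_eq_iff)
  have int: "integrable M (\<lambda>\<omega>. \<tau> 0 \<omega> ^ i)" for i
    using P.erlang_ith_moment_integrable[OF l gap_distributed[of 0], of i] by (simp add: \<tau>0)
  have int1: "integrable M (\<tau> 0)" and int2: "integrable M (\<lambda>\<omega>. (\<tau> 0 \<omega>)\<^sup>2)"
    using int[of 1] int[of 2] by simp_all
  have sq: "(\<tau> 0 \<omega> + B / v)\<^sup>2 = (\<tau> 0 \<omega>)\<^sup>2 + (2 * (B / v)) * \<tau> 0 \<omega> + (B / v)\<^sup>2" for \<omega>
    by (simp add: power2_eq_square algebra_simps)
  note b = cover_time_bounds[OF v B(2), of \<tau> \<sigma>]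
  have "\<bar>cover_time v \<tau> \<sigma> \<omega>\<bar> \<le> \<bar>\<tau> 0 \<omega> + B / v\<bar>" for \<omega>
    using b[of \<omega>] by linarith
  then have "integrable M (\<lambda>\<omega>. \<tau> 0 \<omega> + B / v) \<Longrightarrow> integrable M (cover_time v \<tau> \<sigma>)"
    and sq_le: "\<And>\<omega>. (cover_time v \<tau> \<sigma> \<omega>)\<^sup>2 \<le> (\<tau> 0 \<omega> + B / v)\<^sup>2"
    by (auto intro: Bochner_Integration.integrable_bound simp: abs_le_square_iff)
  then show "integrable M (cover_time v \<tau> \<sigma>)"
    using int1 by simp
  have "integrable M (\<lambda>\<omega>. (\<tau> 0 \<omega> + B / v)\<^sup>2)"
    unfolding sq using int1 int2 by simp
  then show "integrable M (\<lambda>\<omega>. (cover_time v \<tau> \<sigma> \<omega>)\<^sup>2)"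
    by (rule Bochner_Integration.integrable_bound) (use sq_le in auto)
qed

lemma integrable_point_cover_time: "integrable M (point_cover_time v \<tau> \<sigma> s)"
proof -
  obtain B where B: "0 \<le> B" "\<And>x y :: 'a. dist x y \<le> B"
    using dist_bounded by blast
  have "\<bar>point_cover_time v \<tau> \<sigma> s \<omega>\<bar> \<le> \<bar>cover_time v \<tau> \<sigma> \<omega>\<bar>" for \<omega>
    using point_cover_time_nonneg[OF v, of \<tau> \<sigma> s \<omega>]
      point_cover_time_le_cover_time[OF v B(2), of \<tau> \<sigma> s \<omega>] by linarith
  then show ?thesis
    by (intro Bochner_Integration.integrable_bound[OF integrable_cover_time_power(1)]) auto
qed

text \<open>The mean inherits the Lipschitz constant \<open>1 / v\<close> in \<open>s\<close> from
  the point cover times, so compactness turns the supremum into a maximum.\<close>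

lemma mean_point_cover_time_attains_max:
  obtains s where "\<And>s'. (\<integral>\<omega>. point_cover_time v \<tau> \<sigma> s' \<omega> \<partial>M) \<le> (\<integral>\<omega>. point_cover_time v \<tau> \<sigma> s \<omega> \<partial>M)"
    and "max_mean_point_cover_time M v \<tau> \<sigma> = (\<integral>\<omega>. point_cover_time v \<tau> \<sigma> s \<omega> \<partial>M)"
proof -
  define m where "m = (\<lambda>s. \<integral>\<omega>. point_cover_time v \<tau> \<sigma> s \<omega> \<partial>M)"
  have le: "m s \<le> m s' + 1 / v * dist s s'" for s s'
  proof -
    have "m s \<le> (\<integral>\<omega>. point_cover_time v \<tau> \<sigma> s' \<omega> + 1 / v * dist s s' \<partial>M)"
      unfolding m_def
      by (intro integral_mono integrable_point_cover_time Bochner_Integration.integrable_add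
        P.integrable_const point_cover_time_lipschitz[OF v])
    then show ?thesis
      using P.prob_space by (simp add: m_def integrable_point_cover_time)
  qed
  have "(1 / v)-lipschitz_on UNIV m"
  proof (rule lipschitz_onI)
    show "dist (m x) (m y) \<le> 1 / v * dist x y" for x y
      using le[of x y] le[of y x] by (auto simp: dist_real_def abs_le_iff dist_commute)
  qed (use v in auto)
  then obtain s where s: "\<And>s'. m s' \<le> m s"
    using continuous_attains_sup[OF compact, of m] lipschitz_on_continuous_on by auto
  moreover have "(SUP s. m s) = m s"
    using s by (intro cSup_eq_maximum) auto
  ultimately show thesis
    by (intro that[of s]) (auto simp: m_def max_mean_point_cover_time_def)
qed

text \<open>Almost surely nothing is covered before the first seed, whose mean arrival time is
  \<open>1 / l\<close>.\<close>

lemma expectation_cover_time_pos: "0 < (\<integral>\<omega>. cover_time v \<tau> \<sigma> \<omega> \<partial>M)"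
proof -
  obtain B where B: "0 \<le> B" "\<And>x y :: 'a. dist x y \<le> B"
    using dist_bounded by blast
  have "P.expectation (gap \<tau> 0) = 1 / l"
    using P.erlang_ith_moment[OF l gap_distributed[of 0], of 1] by simp
  moreover have "P.expectation (gap \<tau> 0) \<le> (\<integral>\<omega>. cover_time v \<tau> \<sigma> \<omega> \<partial>M)"
  proof (rule integral_mono_AE)
    show "integrable M (gap \<tau> 0)"
      using P.erlang_ith_moment_integrable[OF l gap_distributed[of 0], of 1] by simp
    show "AE \<omega> in M. gap \<tau> 0 \<omega> \<le> cover_time v \<tau> \<sigma> \<omega>"
      using AE_gap_nonneg
    proof eventually_elim
      fix \<omega> assume nn: "\<forall>i. 0 \<le> gap \<tau> i \<omega>"
      have "gap \<tau> 0 \<omega> \<le> point_cover_time v \<tau> \<sigma> undefined \<omega>"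
        unfolding point_cover_time_eq[OF v]
      proof (rule cINF_greatest)
        fix i
        have "gap \<tau> 0 \<omega> \<le> \<tau> i \<omega>"
          using sum_mono2[of "{..i}" "{..0}" "\<lambda>k. gap \<tau> k \<omega>"] nn by (simp add: sum_gap)
        moreover have "0 \<le> dist (\<sigma> i \<omega>) undefined / v" using v by simp
        ultimately show "gap \<tau> 0 \<omega> \<le> max 0 (\<tau> i \<omega> + dist (\<sigma> i \<omega>) undefined / v)"
          by linarith
      qed simp
      also have "\<dots> \<le> cover_time v \<tau> \<sigma> \<omega>"
        by (rule point_cover_time_le_cover_time[OF v B(2)])
      finally show "gap \<tau> 0 \<omega> \<le> cover_time v \<tau> \<sigma> \<omega>" .
    qed
  qed (rule integrable_cover_time_power)
  ultimately show ?thesis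
    using l by (auto intro: less_le_trans[rotated])
qed

text \<open>The constant profile \<open>N\<close> turns the residual time into the cover time
  truncated at \<open>N\<close>. For single points truncation only lowers the mean, so one constant
  bounds the jumps for every \<open>N\<close>.\<close>

lemma variance_min_cover_time:
  assumes N: "0 \<le> N"
  defines "C \<equiv> \<lambda>\<omega>. min (cover_time v \<tau> \<sigma> \<omega>) N"
  shows "(\<integral>\<omega>. (C \<omega>)\<^sup>2 \<partial>M) - (\<integral>\<omega>. C \<omega> \<partial>M)\<^sup>2 \<le> max_mean_point_cover_time M v \<tau> \<sigma> * (\<integral>\<omega>. C \<omega> \<partial>M)"
proof -
  obtain D :: "'a set" where D: "countable D" "D \<noteq> {}" "\<And>x e. 0 < e \<Longrightarrow> \<exists>d\<in>D. dist x d < e"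
    using countable_dense_compact[OF compact] by blast
  obtain B where B: "0 \<le> B" "\<And>x y :: 'a. dist x y \<le> B"
    using dist_bounded by blast
  have prof: "profile N (\<lambda>_::'a. N)"
    using N by (simp add: profile_def)
  \<comment> \<open>Truncation is monotone and continuous, hence passes through suprema.\<close>
  have min_SUP: "min N (SUP s\<in>A. f s) = (SUP s\<in>A. min N (f s))"
    if "A \<noteq> {}" "bdd_above (f ` A)" for A :: "'a set" and f
  proof -
    have "min N (Sup (f ` A)) = (SUP x\<in>f ` A. min N x)"
      using that by (intro continuous_at_Sup_mono continuous_intros) (auto simp: mono_def min_def)
    then show ?thesis by (simp add: image_comp)
  qed
  have residual_time: "AE \<omega> in M. C \<omega> = residual_time v D (\<lambda>_. N) (sample \<omega>)"
    using AE_gap_nonneg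
  proof eventually_elim
    fix \<omega> assume nn: "\<forall>i. 0 \<le> gap \<tau> i \<omega>"
    have "bdd_above ((\<lambda>s. point_cover_time v \<tau> \<sigma> s \<omega>) ` D)"
      using bdd_above_point_cover_time[OF v B(2)] by (rule bdd_above_mono) auto
    then show "C \<omega> = residual_time v D (\<lambda>_. N) (sample \<omega>)"
      by (simp add: C_def residual_time_def hit_sample[OF nn] cover_time_SUP_dense[OF D(2,3)]
        min_SUP[OF D(2)] min.commute[of _ N])
  qed
  have meas: "(\<lambda>\<omega>. residual_time v E (\<lambda>_. N) (sample \<omega>)) \<in> borel_measurable M" if "countable E" "E \<noteq> {}" for E
    using measurable_compose[OF sample_measurable residual_time_measurable[OF that prof]] .
  have C_meas: "C \<in> borel_measurable M"
    unfolding C_def by measurable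
  have EC: "(\<integral>\<omega>. C \<omega> \<partial>M) = mean D (\<lambda>_. N)"
  proof -
    have "mean D (\<lambda>_. N) = (\<integral>\<omega>. residual_time v D (\<lambda>_. N) (sample \<omega>) \<partial>M)"
      unfolding mean_def by (subst distr_sample[symmetric], rule integral_distr)
        (auto intro: residual_time_measurable[OF D(1,2) prof])
    also have "\<dots> = (\<integral>\<omega>. C \<omega> \<partial>M)"
      using residual_time C_meas meas[OF D(1,2)] by (intro integral_cong_AE) auto
    finally show ?thesis by simp
  qed
  have EC2: "(\<integral>\<omega>. (C \<omega>)\<^sup>2 \<partial>M) = second_moment D (\<lambda>_. N)"
  proof -
    have "second_moment D (\<lambda>_. N) = (\<integral>\<omega>. (residual_time v D (\<lambda>_. N) (sample \<omega>))\<^sup>2 \<partial>M)"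
      unfolding second_moment_def by (subst distr_sample[symmetric], rule integral_distr)
        (auto intro!: borel_measurable_power residual_time_measurable[OF D(1,2) prof])
    also have "\<dots> = (\<integral>\<omega>. (C \<omega>)\<^sup>2 \<partial>M)"
      using residual_time C_meas meas[OF D(1,2)] by (intro integral_cong_AE) auto
    finally show ?thesis by simp
  qed
  obtain s where s: "\<And>s'. (\<integral>\<omega>. point_cover_time v \<tau> \<sigma> s' \<omega> \<partial>M) \<le> (\<integral>\<omega>. point_cover_time v \<tau> \<sigma> s \<omega> \<partial>M)"
    and max: "max_mean_point_cover_time M v \<tau> \<sigma> = (\<integral>\<omega>. point_cover_time v \<tau> \<sigma> s \<omega> \<partial>M)"
    using mean_point_cover_time_attains_max by metis
  have "mean {x} (\<lambda>_. N) \<le> max_mean_point_cover_time M v \<tau> \<sigma>" for x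
  proof -
    have "mean {x} (\<lambda>_. N) = (\<integral>\<omega>. residual_time v {x} (\<lambda>_. N) (sample \<omega>) \<partial>M)"
      unfolding mean_def by (subst distr_sample[symmetric], rule integral_distr)
        (auto intro: residual_time_measurable[OF _ _ prof])
    also have "\<dots> \<le> (\<integral>\<omega>. point_cover_time v \<tau> \<sigma> x \<omega> \<partial>M)"
    proof (rule integral_mono_AE)
      show "integrable M (\<lambda>\<omega>. residual_time v {x} (\<lambda>_. N) (sample \<omega>))"
        by (rule P.integrable_const_bound[of _ N]) (auto intro: residual_time_bound[OF _ _ prof] meas)
      show "AE \<omega> in M. residual_time v {x} (\<lambda>_. N) (sample \<omega>) \<le> point_cover_time v \<tau> \<sigma> x \<omega>"
        using AE_gap_nonneg by eventually_elim (simp add: residual_time_def hit_sample)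
    qed (rule integrable_point_cover_time)
    also have "\<dots> \<le> max_mean_point_cover_time M v \<tau> \<sigma>"
      unfolding max by (rule s)
    finally show ?thesis .
  qed
  from variance_bound[OF D(1,2) prof this] show ?thesis
    by (simp add: EC EC2)
qed

text \<open>The truncated bound has a constant independent of the level, so dominated convergence
  with majorants \<open>C\<close> and its square removes the truncation.\<close>

lemma variance_cover_time:
  "(\<integral>\<omega>. (cover_time v \<tau> \<sigma> \<omega>)\<^sup>2 \<partial>M) - (\<integral>\<omega>. cover_time v \<tau> \<sigma> \<omega> \<partial>M)\<^sup>2
    \<le> max_mean_point_cover_time M v \<tau> \<sigma> * (\<integral>\<omega>. cover_time v \<tau> \<sigma> \<omega> \<partial>M)"
proof -
  define C where "C = cover_time v \<tau> \<sigma>"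
  obtain B where B: "0 \<le> B" "\<And>x y :: 'a. dist x y \<le> B"
    using dist_bounded by blast
  have nn: "0 \<le> C \<omega>" for \<omega>
    unfolding C_def by (rule cover_time_bounds[OF v B(2)])
  have [measurable]: "C \<in> borel_measurable M"
    unfolding C_def by measurable
  have lim: "(\<lambda>n. min (C \<omega>) (real n)) \<longlonglongrightarrow> C \<omega>" for \<omega>
  proof (rule tendsto_eventually)
    obtain N where "C \<omega> \<le> real N" using real_arch_simple by blast
    then show "eventually (\<lambda>n. min (C \<omega>) (real n) = C \<omega>) sequentially"
      by (intro eventually_sequentiallyI[of N]) auto
  qed
  have 1: "(\<lambda>n. \<integral>\<omega>. min (C \<omega>) (real n) \<partial>M) \<longlonglongrightarrow> (\<integral>\<omega>. C \<omega> \<partial>M)"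
    by (rule integral_dominated_convergence[where w = C])
      (use nn lim integrable_cover_time_power(1) in \<open>auto simp: C_def[symmetric]\<close>)
  have 2: "(\<lambda>n. \<integral>\<omega>. (min (C \<omega>) (real n))\<^sup>2 \<partial>M) \<longlonglongrightarrow> (\<integral>\<omega>. (C \<omega>)\<^sup>2 \<partial>M)"
  proof (rule integral_dominated_convergence[where w = "\<lambda>\<omega>. (C \<omega>)\<^sup>2"])
    show "AE \<omega> in M. (\<lambda>n. (min (C \<omega>) (real n))\<^sup>2) \<longlonglongrightarrow> (C \<omega>)\<^sup>2"
      by (intro AE_I2 tendsto_power lim)
    show "AE \<omega> in M. norm ((min (C \<omega>) (real n))\<^sup>2) \<le> (C \<omega>)\<^sup>2" for n
      using nn by (auto intro!: AE_I2 power_mono)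
  qed (use integrable_cover_time_power(2) in \<open>auto simp: C_def[symmetric]\<close>)
  show ?thesis
    unfolding C_def[symmetric]
    by (rule LIMSEQ_le[OF tendsto_diff[OF 2 tendsto_power[OF 1]] tendsto_mult[OF tendsto_const 1]])
      (use variance_min_cover_time in \<open>auto simp: C_def\<close>)
qed

end

text \<open>The clauses before the inequality certify its terms: the infima are almost surely
  minima, the supremum is a maximum, the integrals exist and the denominator is positive, so no
  default value enters.\<close>

theorem proposition3:
  fixes M :: "'w measure" and \<mu> :: "'a::metric_space measure"
    and \<tau> :: "nat \<Rightarrow> 'w \<Rightarrow> real" and \<sigma> :: "nat \<Rightarrow> 'w \<Rightarrow> 'a"
    and l v :: real
  assumes "compact (UNIV :: 'a set)"
    and "prob_space \<mu>" and "sets \<mu> = sets borel"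
    and "0 < l" and "0 < v"
    and "prob_space M"
    and "poisson_times M l \<tau>"
    and "iid_points M \<mu> \<sigma>"
    and "indep_sequences M \<tau> \<sigma>"
  shows "let C = cover_time v \<tau> \<sigma>;
             EC = prob_space.expectation M C;
             m = (\<lambda>s. prob_space.expectation M (point_cover_time v \<tau> \<sigma> s));
             c = max_mean_point_cover_time M v \<tau> \<sigma>
         in (AE \<omega> in M. C \<omega> \<in> covering_times v \<tau> \<sigma> \<omega> \<and>
                        (\<forall>t\<in>covering_times v \<tau> \<sigma> \<omega>. C \<omega> \<le> t)) \<and>
            (\<forall>s. AE \<omega> in M. point_cover_time v \<tau> \<sigma> s \<omega> \<in> point_covering_times v \<tau> \<sigma> s \<omega> \<and>
                        (\<forall>t\<in>point_covering_times v \<tau> \<sigma> s \<omega>. point_cover_time v \<tau> \<sigma> s \<omega> \<le> t)) \<and>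
            (\<forall>s. integrable M (point_cover_time v \<tau> \<sigma> s)) \<and>
            (\<exists>s. m s = c \<and> (\<forall>s'. m s' \<le> c)) \<and>
            integrable M C \<and> integrable M (\<lambda>\<omega>. (C \<omega>)\<^sup>2) \<and> 0 < EC \<and>
            prob_space.variance M (\<lambda>\<omega>. C \<omega> / EC) \<le> c / EC"
proof -
  interpret growth_process l v \<mu> M \<tau> \<sigma>
    by (intro growth_process.intro growth.intro growth_process_axioms.intro assms)
  obtain B where B: "0 \<le> B" "\<And>x y :: 'a. dist x y \<le> B"
    using dist_bounded by blast
  define C where "C = cover_time v \<tau> \<sigma>"
  define EC where "EC = P.expectation C"
  define c where "c = max_mean_point_cover_time M v \<tau> \<sigma>"
  have "AE \<omega> in M. C \<omega> \<in> covering_times v \<tau> \<sigma> \<omega> \<and> (\<forall>t\<in>covering_times v \<tau> \<sigma> \<omega>. C \<omega> \<le> t)"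
    using AE_arrivals_finite
  proof eventually_elim
    fix \<omega> assume "\<forall>K. finite {i. \<tau> i \<omega> \<le> K}"
    then have "finite {i. \<tau> i \<omega> \<le> K}" for K by blast
    then show "C \<omega> \<in> covering_times v \<tau> \<sigma> \<omega> \<and> (\<forall>t\<in>covering_times v \<tau> \<sigma> \<omega>. C \<omega> \<le> t)"
      unfolding C_def by (intro conjI ballI cover_time_attained[OF v B(2)] cover_time_le[OF v B(2)])
  qed
  moreover have "AE \<omega> in M. point_cover_time v \<tau> \<sigma> s \<omega> \<in> point_covering_times v \<tau> \<sigma> s \<omega> \<and>
      (\<forall>t\<in>point_covering_times v \<tau> \<sigma> s \<omega>. point_cover_time v \<tau> \<sigma> s \<omega> \<le> t)" for s
    using AE_arrivals_finite
  proof eventually_elim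
    fix \<omega> assume "\<forall>K. finite {i. \<tau> i \<omega> \<le> K}"
    then have "finite {i. \<tau> i \<omega> \<le> K}" for K by blast
    then show "point_cover_time v \<tau> \<sigma> s \<omega> \<in> point_covering_times v \<tau> \<sigma> s \<omega> \<and>
        (\<forall>t\<in>point_covering_times v \<tau> \<sigma> s \<omega>. point_cover_time v \<tau> \<sigma> s \<omega> \<le> t)"
      by (intro conjI ballI point_cover_time_attained[OF v] point_cover_time_le[OF v])
  qed
  moreover have "\<exists>s. P.expectation (point_cover_time v \<tau> \<sigma> s) = c \<and>
      (\<forall>s'. P.expectation (point_cover_time v \<tau> \<sigma> s') \<le> c)"
    by (rule mean_point_cover_time_attains_max) (auto simp: c_def)
  moreover have int: "integrable M C" "integrable M (\<lambda>\<omega>. (C \<omega>)\<^sup>2)"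
    using integrable_cover_time_power by (simp_all add: C_def)
  moreover have pos: "0 < EC"
    using expectation_cover_time_pos by (simp add: EC_def C_def)
  moreover have "P.variance (\<lambda>\<omega>. C \<omega> / EC) \<le> c / EC"
  proof -
    have "P.variance (\<lambda>\<omega>. C \<omega> / EC) = P.expectation (\<lambda>\<omega>. (C \<omega>)\<^sup>2) / EC\<^sup>2 - (EC / EC)\<^sup>2"
      using int by (subst P.variance_eq) (auto simp: power_divide EC_def)
    also have "\<dots> = (P.expectation (\<lambda>\<omega>. (C \<omega>)\<^sup>2) - EC\<^sup>2) / EC\<^sup>2"
      using pos by (simp add: diff_divide_distrib)
    also have "\<dots> \<le> (c * EC) / EC\<^sup>2"
      using variance_cover_time by (intro divide_right_mono) (auto simp: C_def EC_def c_def)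
    also have "\<dots> = c / EC"
      using pos by (simp add: power2_eq_square)
    finally show ?thesis .
  qed
  ultimately show ?thesis
    using integrable_point_cover_time
    unfolding Let_def C_def[symmetric] EC_def[symmetric] c_def[symmetric] by blast
qed

end
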